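(* Let $A$ be a $C^*$-algebra and let $I \subseteq A$ be a (two-sided, not necessarily norm-closed) ideal. Then either $I = I^2 = I^3 = \ldots$ (that is, $I^n = I$ for all $n \geq 1$), or $I \supsetneqq I^2 \supsetneqq I^3 \supsetneqq \ldots$ (that is, $I^{n+1}$ is a proper subset of $I^n$ for all $n \geq 1$).
   Context: $C^*$-algebras are not assumed unital. An ideal in a $C^*$-algebra $A$ is an additive subgroup $I \subseteq A$ with $aI \cup Ia \subseteq I$ for all $a \in A$; it is not assumed norm-closed, self-adjoint, or closed under complex scalars. $I^n$ denotes the additive subgroup generated by $\{x_1\cdots x_n : x_1,\ldots,x_n \in I\}$ (which is again an ideal), with $I^1 = I$. *)

theory Defs
  imports "HOL-Analysis.Analysis" "HOL-Computational_Algebra.Group_Closure"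
begin

text \<open>
  \<^class>\<open>real_normed_algebra\<close> assumes neither a unit nor \<open>0 \<noteq> 1\<close>, so non-unital algebras and the
  zero algebra are included. The real scalar multiplication it provides is tied to the complex one
  by \<open>scaleC_of_real\<close>.
\<close>

class cstar_algebra = real_normed_algebra + banach +
  fixes scaleC :: "complex \<Rightarrow> 'a \<Rightarrow> 'a"  (infixr \<open>*\<^sub>C\<close> 75)
    and star :: "'a \<Rightarrow> 'a"
  assumes scaleC_add_right: "c *\<^sub>C (x + y) = c *\<^sub>C x + c *\<^sub>C y"
    and scaleC_add_left: "(c + d) *\<^sub>C x = c *\<^sub>C x + d *\<^sub>C x"
    and scaleC_scaleC: "c *\<^sub>C (d *\<^sub>C x) = (c * d) *\<^sub>C x"
    and scaleC_of_real: "complex_of_real r *\<^sub>C x = r *\<^sub>R x"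
    and mult_scaleC_left: "(c *\<^sub>C x) * y = c *\<^sub>C (x * y)"
    and mult_scaleC_right: "x * (c *\<^sub>C y) = c *\<^sub>C (x * y)"
    and norm_scaleC: "norm (c *\<^sub>C x) = cmod c * norm x"
    and star_add: "star (x + y) = star x + star y"
    and star_scaleC: "star (c *\<^sub>C x) = cnj c *\<^sub>C star x"
    and star_mult: "star (x * y) = star y * star x"
    and star_star: "star (star x) = x"
    and norm_star_mult: "norm (star x * x) = (norm x)\<^sup>2"

instantiation complex :: cstar_algebra
begin
definition "scaleC_complex = ((*) :: complex \<Rightarrow> complex \<Rightarrow> complex)"
definition "star_complex = cnj"
instance
  by standard
    (simp_all add: scaleC_complex_def star_complex_def algebra_simps norm_mult power2_eq_square
       scaleR_conv_of_real)
end

definition two_sided_ideal :: "'a::ring set \<Rightarrow> bool" where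
  "two_sided_ideal I \<longleftrightarrow>
     0 \<in> I \<and> (\<forall>x\<in>I. \<forall>y\<in>I. x + y \<in> I) \<and> (\<forall>x\<in>I. - x \<in> I) \<and>
     (\<forall>a. \<forall>x\<in>I. a * x \<in> I \<and> x * a \<in> I)"

text \<open>
  Without a unit there is no empty product, so a product of \<open>n\<close> factors is a first factor
  multiplied by a list of \<open>n - 1\<close> further ones. The value at \<open>n = 0\<close>, the zero subgroup, carries
  no meaning.
\<close>

definition ideal_power :: "'a::ring set \<Rightarrow> nat \<Rightarrow> 'a set" where
  "ideal_power I n =
     group_closure {foldl (*) x xs | x xs. x \<in> I \<and> set xs \<subseteq> I \<and> Suc (length xs) = n}"

lemma ideal_power_1:
  assumes "two_sided_ideal I"
  shows "ideal_power I 1 = I"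
proof -
  have eq: "{foldl (*) x xs | x xs. x \<in> I \<and> set xs \<subseteq> I \<and> Suc (length xs) = 1} = I"
    by force
  have "s \<in> I" if "s \<in> group_closure I" for s
    using that
  proof induction
    case (base s)
    then show ?case
      using assms by (auto simp: two_sided_ideal_def)
  next
    case (diff s t)
    then have "s + (- t) \<in> I"
      using assms unfolding two_sided_ideal_def by blast
    then show ?case
      by simp
  qed
  moreover have "I \<subseteq> group_closure I"
    by (auto intro: group_closure.base)
  ultimately show ?thesis
    unfolding ideal_power_def eq by blast
qed

end

theory Submission
  imports Defs
begin

text \<open>
  If \<open>I\<^sup>n = I\<^sup>n\<^sup>+\<^sup>1\<close>, then \<open>J = I\<^sup>n\<close> satisfies \<open>J = J\<^sup>2\<close>, and it contains \<open>(x\<^sup>* x)\<^sup>n\<close> for \<open>x \<in> I\<close>. Since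
  \<open>x \<in> A (x\<^sup>* x)\<^sup>1\<^sup>/\<^sup>4\<close>, it suffices that an idempotent ideal \<open>J\<close> is closed under square roots of
  positive elements.

  Let \<open>a = \<Sum> x\<^sub>1 \<cdots> x\<^sub>N\<close> be positive with all factors in \<open>J\<close>, where \<open>N\<close> is as large as we please, and
  put \<open>b = (\<Sum> x\<^sub>i\<^sup>* x\<^sub>i)\<^sup>1\<^sup>/\<^sup>8\<close>, so that \<open>b\<^sup>8 \<in> J\<close>. If \<open>x\<^sup>* x \<le> C b\<^sup>2\<^sup>k\<^sup>+\<^sup>2\<close> then \<open>x \<in> A b\<^sup>k\<close>; hence
  every \<open>x\<^sub>i\<close> lies in the ideal generated by \<open>b\<^sup>3\<close>, and a product of two elements of the ideal
  generated by \<open>b\<^sup>n\<close> lies in the one generated by \<open>b\<^sup>2\<^sup>n\<^sup>-\<^sup>2\<close>. So \<open>a\<close> lies in the ideal generated by a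
  high power of \<open>b\<close>, and therefore \<open>a \<le> g = \<Sum> r\<^sup>* b\<^sup>M r\<close> with \<open>M\<close> large. Taking a square root of such
  a sum leads to a sum of the same form in which \<open>M\<close> is roughly halved, so \<open>g\<^sup>1\<^sup>/\<^sup>4 \<in> J\<close>, and
  \<open>a\<^sup>1\<^sup>/\<^sup>2 \<in> A g\<^sup>1\<^sup>/\<^sup>4\<close>.
\<close>

subsection \<open>The unital case: square roots and positivity\<close>

text \<open>Positivity and square roots need a unit; arbitrary algebras are reached through their
  unitization, which is an instance of this class.\<close>

class cstar_algebra_1 = cstar_algebra + real_normed_algebra_1

section \<open>Elementary rules for complex scalars and the involution\<close>

lemma scaleC_minus_left: "(- c) *\<^sub>C x = - (c *\<^sub>C (x::'a::cstar_algebra))"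
proof -
  have "c *\<^sub>C x + (- c) *\<^sub>C x = complex_of_real 0 *\<^sub>C x"
    by (simp flip: scaleC_add_left)
  then have "c *\<^sub>C x + (- c) *\<^sub>C x = 0"
    unfolding scaleC_of_real by simp
  then show ?thesis
    by (simp add: eq_neg_iff_add_eq_0 add.commute)
qed

lemma scaleC_minus_right: "c *\<^sub>C (- x) = - (c *\<^sub>C (x::'a::cstar_algebra))"
proof -
  have "c *\<^sub>C 0 = (0::'a)"
    using scaleC_add_right [of c 0 "0::'a"] by simp
  then have "c *\<^sub>C (- x) + c *\<^sub>C x = 0"
    by (simp flip: scaleC_add_right)
  then show ?thesis
    by (simp add: eq_neg_iff_add_eq_0)
qed

lemma scaleC_diff_right: "c *\<^sub>C (x - y) = c *\<^sub>C x - c *\<^sub>C (y::'a::cstar_algebra)"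
  using scaleC_add_right [of c x "- y"] by (simp add: scaleC_minus_right)

lemma star_zero [simp]: "star (0::'a::cstar_algebra) = 0"
  using star_add [of "0::'a" 0] by simp

lemma star_minus [simp]: "star (- x) = - star (x::'a::cstar_algebra)"
  using star_add [of x "- x"] by (simp add: eq_neg_iff_add_eq_0 add.commute)

lemma star_diff: "star (x - y) = star x - star (y::'a::cstar_algebra)"
  using star_add [of x "- y"] by simp

lemma star_scaleR: "star (r *\<^sub>R x) = r *\<^sub>R star (x::'a::cstar_algebra)"
  by (simp flip: scaleC_of_real add: star_scaleC)

lemma star_one [simp]: "star (1::'a::cstar_algebra_1) = 1"
  using star_mult [of "star 1" "1::'a"] by (simp add: star_star)

lemma star_power: "star (x ^ n) = star (x::'a::cstar_algebra_1) ^ n"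
  by (induction n) (simp_all add: star_mult power_commutes)

text \<open>The C*-identity and submultiplicativity give
  \<open>norm y ^ 2 <= norm (star y) * norm y\<close>; cancelling, once for \<open>x\<close> and
  once for \<open>star x\<close>, gives both inequalities.\<close>

lemma norm_star [simp]: "norm (star x) = norm (x::'a::cstar_algebra)"
proof -
  have "norm y \<le> norm (star y)" for y :: 'a
  proof (cases "y = 0")
    case False
    have "norm y * norm y \<le> norm (star y) * norm y"
      using norm_star_mult [of y] norm_mult_ineq [of "star y" y] by (simp add: power2_eq_square)
    with False show ?thesis
      by simp
  qed simp
  from this [of x] this [of "star x"] show ?thesis
    by (simp add: star_star)
qed

lemma bounded_linear_star: "bounded_linear (star :: 'a::cstar_algebra \<Rightarrow> 'a)"
  by (rule bounded_linear_intro [where K = 1]) (simp_all add: star_add star_scaleR)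

lemma tendsto_star:
  "((\<lambda>x. f x :: 'a::cstar_algebra) \<longlongrightarrow> a) F \<Longrightarrow> ((\<lambda>x. star (f x)) \<longlongrightarrow> star a) F"
  by (rule bounded_linear.tendsto [OF bounded_linear_star])

lemma norm_mult_star: "norm (x * star x) = (norm (x::'a::cstar_algebra))\<^sup>2"
  using norm_star_mult [of "star x"] by (simp add: star_star)

section \<open>The square root of \<open>1 - h\<close> by the binomial series\<close>

definition sqrt_coeff :: "nat \<Rightarrow> real" where
  "sqrt_coeff n = (1/2 gchoose n) * (-1) ^ n"

lemma sqrt_coeff_0 [simp]: "sqrt_coeff 0 = 1"
  by (simp add: sqrt_coeff_def)

lemma sqrt_coeff_Suc: "sqrt_coeff (Suc n) = sqrt_coeff n * (real n - 1/2) / (real n + 1)"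
proof -
  have g: "(real n + 1) * (1/2 gchoose Suc n) = (1/2 gchoose n) * (1/2 - real n)"
    using gbinomial_mult_1 [of "1/2::real" n] by (simp add: algebra_simps)
  have "(real n + 1) * sqrt_coeff (Suc n) = ((real n + 1) * (1/2 gchoose Suc n)) * - ((-1) ^ n)"
    by (simp add: sqrt_coeff_def)
  also have "\<dots> = sqrt_coeff n * (real n - 1/2)"
    unfolding g sqrt_coeff_def by (simp add: algebra_simps)
  finally show ?thesis
    by (simp add: nonzero_eq_divide_eq mult.commute)
qed

lemma sqrt_coeff_nonpos: "sqrt_coeff (Suc n) \<le> 0"
proof (induction n)
  case 0
  then show ?case by (simp add: sqrt_coeff_Suc)
next
  case (Suc n)
  then show ?case
    by (subst sqrt_coeff_Suc) (auto intro!: divide_nonpos_nonneg mult_nonpos_nonneg)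
qed

text \<open>The series of \<open>sqrt (1 - t)\<close> multiplied by itself must be
  \<open>1 - t\<close>; Vandermonde's identity turns the sum into \<open>1 choose n\<close> up to
  sign.\<close>

lemma sqrt_coeff_convolution:
  "(\<Sum>i\<le>n. sqrt_coeff i * sqrt_coeff (n - i)) = (if n = 0 then 1 else if n = 1 then -1 else 0)"
proof -
  have "(\<Sum>i\<le>n. sqrt_coeff i * sqrt_coeff (n - i))
      = (-1) ^ n * (\<Sum>i\<le>n. (1/2 gchoose i) * (1/2 gchoose (n - i)))"
    unfolding sum_distrib_left
  proof (rule sum.cong [OF refl])
    fix i assume "i \<in> {..n}"
    then have "(-1::real) ^ n = (-1) ^ i * (-1) ^ (n - i)"
      by (simp flip: power_add)
    then show "sqrt_coeff i * sqrt_coeff (n - i)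
        = (-1) ^ n * ((1/2 gchoose i) * (1/2 gchoose (n - i)))"
      by (simp add: sqrt_coeff_def)
  qed
  also have "(\<Sum>i\<le>n. (1/2 gchoose i) * (1/2 gchoose (n - i))) = ((1::real) gchoose n)"
    using gbinomial_Vandermonde [of "1/2::real" "1/2" n] by (simp add: atMost_atLeast0)
  also have "(1::real) gchoose n = of_nat (1 choose n)"
    using binomial_gbinomial [of 1 n, where 'a = real] by simp
  finally show ?thesis
    by (auto simp: binomial_eq_0)
qed

text \<open>For \<open>0 <= t < 1\<close> the sum weighted by powers of \<open>t\<close> is at most
  \<open>1 - sqrt (1 - t) <= 1\<close>, as all terms are nonnegative; a finite sum permits the limit
  at 1. This gives absolute convergence on the closed unit ball, boundary included.\<close>

lemma sqrt_coeff_partial_sum: "(\<Sum>n<N. - sqrt_coeff (Suc n)) \<le> 1"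
proof -
  have le: "(\<Sum>n<N. - sqrt_coeff (Suc n) * t ^ Suc n) \<le> 1" if t: "0 \<le> t" "t < 1" for t :: real
  proof -
    have "(\<lambda>n. sqrt_coeff n * t ^ n) sums (1 - t) powr (1/2)"
      using gen_binomial_real [of "- t" "1/2"] t
      by (simp add: sqrt_coeff_def power_minus [of t] mult.assoc)
    then have "(\<lambda>n. sqrt_coeff (Suc n) * t ^ Suc n) sums ((1 - t) powr (1/2) - 1)"
      by (subst sums_Suc_iff) simp
    then have s: "(\<lambda>n. - sqrt_coeff (Suc n) * t ^ Suc n) sums (1 - (1 - t) powr (1/2))"
      using sums_minus by fastforce
    have "(\<Sum>n<N. - sqrt_coeff (Suc n) * t ^ Suc n) \<le> 1 - (1 - t) powr (1/2)"
    proof -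
      have "0 \<le> - sqrt_coeff (Suc n) * t ^ Suc n" for n
        using sqrt_coeff_nonpos [of n] t by (intro mult_nonneg_nonneg) auto
      then show ?thesis
        using sum_le_suminf [OF sums_summable [OF s], of "{..<N}"] sums_unique [OF s] by simp
    qed
    then show ?thesis
      using powr_ge_zero [of "1 - t" "1/2"] by linarith
  qed
  have lim: "((\<lambda>t. \<Sum>n<N. - sqrt_coeff (Suc n) * t ^ Suc n)
      \<longlongrightarrow> (\<Sum>n<N. - sqrt_coeff (Suc n) * 1 ^ Suc n)) (at_left 1)"
    by (intro tendsto_intros)
  have "\<forall>\<^sub>F t::real in at_left 1. t \<in> {0<..<1}"
    by (rule eventually_at_left_real) simp
  then have "\<forall>\<^sub>F t in at_left 1. (\<Sum>n<N. - sqrt_coeff (Suc n) * t ^ Suc n) \<le> 1"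
    by eventually_elim (rule le, auto)
  then show ?thesis
    using tendsto_upperbound [OF lim] by simp
qed

lemma sqrt_coeff_abs_summable: "summable (\<lambda>n. \<bar>sqrt_coeff (Suc n)\<bar>)"
  and sqrt_coeff_abs_suminf: "(\<Sum>n. \<bar>sqrt_coeff (Suc n)\<bar>) \<le> 1"
proof -
  have eq: "\<bar>sqrt_coeff (Suc n)\<bar> = - sqrt_coeff (Suc n)" for n
    using sqrt_coeff_nonpos [of n] by simp
  show s: "summable (\<lambda>n. \<bar>sqrt_coeff (Suc n)\<bar>)"
    by (rule summableI_nonneg_bounded [where x = 1])
      (use sqrt_coeff_partial_sum in \<open>simp_all only: eq\<close>, use sqrt_coeff_nonpos in auto)
  show "(\<Sum>n. \<bar>sqrt_coeff (Suc n)\<bar>) \<le> 1"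
    by (rule suminf_le_const [OF s]) (use sqrt_coeff_partial_sum in \<open>simp only: eq\<close>)
qed

text \<open>The binomial series converges absolutely even when \<open>norm h = 1\<close>. The bound
  on \<open>1 - s\<close> is the bound on the sum of the coefficients; self-adjointness and
  commutation pass from the powers of \<open>h\<close> to the limit. The commutation clause replaces
  a functional calculus: through it later roots are shown to commute.\<close>

lemma one_minus_sqrt:
  fixes h :: "'a::cstar_algebra_1"
  assumes h: "norm h \<le> 1" and sa: "star h = h"
  obtains s where "s * s = 1 - h" and "norm (1 - s) \<le> 1" and "star s = s"
    and "\<forall>y. y * h = h * y \<longrightarrow> y * s = s * y"
proof -
  define f where "f n = sqrt_coeff n *\<^sub>R h ^ n" for n
  have fbound: "norm (f n) \<le> \<bar>sqrt_coeff n\<bar>" for n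
    using norm_power_ineq [of h n] power_le_one [OF norm_ge_zero h, of n]
    by (simp add: f_def mult_left_le)
  have sumSuc: "summable (\<lambda>n. norm (f (Suc n)))"
    using fbound by (intro summable_comparison_test' [OF sqrt_coeff_abs_summable, of 0]) simp
  then have sumn: "summable (\<lambda>n. norm (f n))"
    using summable_Suc_iff [of "\<lambda>n. norm (f n)"] by blast
  then have sumf: "summable f"
    by (rule summable_norm_cancel)
  define s where "s = suminf f"
  have fs: "f sums s"
    using sumf by (simp add: s_def summable_sums)
  have "(\<lambda>k. \<Sum>i\<le>k. f i * f (k - i)) sums (s * s)"
    unfolding s_def by (rule Cauchy_product_sums [OF sumn sumn])
  moreover have "(\<Sum>i\<le>k. f i * f (k - i)) = (if k \<in> {0, 1} then (if k = 0 then 1 else - h) else 0)" for k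
  proof -
    have "(\<Sum>i\<le>k. f i * f (k - i)) = (\<Sum>i\<le>k. (sqrt_coeff i * sqrt_coeff (k - i)) *\<^sub>R h ^ k)"
      by (rule sum.cong) (auto simp: f_def mult.commute simp flip: power_add)
    also have "\<dots> = (\<Sum>i\<le>k. sqrt_coeff i * sqrt_coeff (k - i)) *\<^sub>R h ^ k"
      by (simp add: scaleR_sum_left)
    finally show ?thesis
      unfolding sqrt_coeff_convolution by simp
  qed
  ultimately have "(\<lambda>k. if k \<in> {0, 1} then (if k = 0 then 1 else - h) else 0) sums (s * s)"
    by simp
  moreover have "(\<lambda>k. if k \<in> {0, 1::nat} then (if k = 0 then 1 else - h) else 0)
      sums (\<Sum>k\<in>{0, 1::nat}. if k = 0 then 1 else - h)"
    by (rule sums_If_finite_set) simp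
  ultimately have "s * s = (\<Sum>k\<in>{0, 1::nat}. if k = 0 then 1 else - h)"
    by (rule sums_unique2)
  then have ss: "s * s = 1 - h"
    by simp
  have "(\<lambda>n. f (Suc n)) sums (s - 1)"
    using fs by (subst sums_Suc_iff) (simp add: f_def)
  then have "norm (s - 1) \<le> (\<Sum>n. norm (f (Suc n)))"
    using summable_norm [OF sumSuc] sums_unique by metis
  also have "\<dots> \<le> (\<Sum>n. \<bar>sqrt_coeff (Suc n)\<bar>)"
    by (rule suminf_le [OF _ sumSuc sqrt_coeff_abs_summable]) (rule fbound)
  finally have n1: "norm (1 - s) \<le> 1"
    using sqrt_coeff_abs_suminf by (simp add: norm_minus_commute)
  have "(\<lambda>n. star (f n)) sums star s"
    by (rule bounded_linear.sums [OF bounded_linear_star fs])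
  moreover have "star (f n) = f n" for n
    by (simp add: f_def star_scaleR star_power sa)
  ultimately have "star s = s"
    using fs sums_unique2 by simp
  moreover have "y * s = s * y" if "y * h = h * y" for y
  proof -
    have "y * f n = f n * y" for n
      using power_commuting_commutes [of h y n] that by (simp add: f_def)
    then show ?thesis
      using sums_mult [OF fs, of y] sums_mult2 [OF fs, of y] sums_unique2 by simp
  qed
  ultimately show ?thesis
    using that ss n1 by blast
qed

section \<open>Positive elements\<close>

text \<open>For self-adjoint \<open>a\<close>, the norm condition says that the spectrum lies in \<open>[0, 2t]\<close>.\<close>

definition cpos :: "'a::cstar_algebra_1 \<Rightarrow> bool" where
  "cpos a \<longleftrightarrow> star a = a \<and> (\<exists>t\<ge>0. norm (t *\<^sub>R 1 - a) \<le> t)"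

lemma cposI: "star a = a \<Longrightarrow> 0 \<le> t \<Longrightarrow> norm (t *\<^sub>R 1 - a) \<le> t \<Longrightarrow> cpos a"
  by (auto simp: cpos_def)

lemma cpos_star: "cpos a \<Longrightarrow> star a = a"
  by (simp add: cpos_def)

text \<open>Scaling gives \<open>a = t (1 - h)\<close> with \<open>norm h <= 1\<close>, so
  \<open>sqrt t\<close> times the series root of \<open>1 - h\<close> works; the bound
  \<open>norm (1 - s) <= 1\<close> is what makes this root positive.\<close>

lemma cpos_sqrt:
  assumes "cpos a"
  obtains s where "cpos s" and "s * s = a" and "\<forall>y. y * a = a * y \<longrightarrow> y * s = s * y"
proof -
  from assms obtain t where sa: "star a = a" and t: "t \<ge> 0" "norm (t *\<^sub>R 1 - a) \<le> t"
    by (auto simp: cpos_def)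
  show ?thesis
  proof (cases "t = 0")
    case True
    with t have "a = 0" by simp
    then show ?thesis
      using that [of 0] by (simp add: cposI [of _ 0])
  next
    case False
    with t have t0: "t > 0" by simp
    define h where "h = 1 - inverse t *\<^sub>R a"
    have h: "h = inverse t *\<^sub>R (t *\<^sub>R 1 - a)"
      using t0 by (simp add: h_def algebra_simps)
    have "norm h = inverse t * norm (t *\<^sub>R 1 - a)"
      using t0 unfolding h by simp
    then have "norm h \<le> 1"
      using mult_left_mono [OF t(2), of "inverse t"] t0 by simp
    moreover have "star h = h"
      by (simp add: h_def star_diff star_scaleR sa)
    ultimately obtain s where s: "s * s = 1 - h" "norm (1 - s) \<le> 1" "star s = s"
      "\<forall>y. y * h = h * y \<longrightarrow> y * s = s * y"
      by (rule one_minus_sqrt)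
    have "norm (sqrt t *\<^sub>R 1 - sqrt t *\<^sub>R s) = sqrt t * norm (1 - s)"
      using t0 by (simp flip: scaleR_diff_right)
    then have "cpos (sqrt t *\<^sub>R s)"
      using t0 s(2,3) by (intro cposI [of _ "sqrt t"]) (simp_all add: star_scaleR mult_left_le)
    moreover have "(sqrt t *\<^sub>R s) * (sqrt t *\<^sub>R s) = a"
      using t0 by (simp add: s(1) h_def flip: mult.assoc)
    moreover have "y * (sqrt t *\<^sub>R s) = (sqrt t *\<^sub>R s) * y" if "y * a = a * y" for y
    proof -
      have "y * h = h * y"
        using that by (simp add: h_def right_diff_distrib left_diff_distrib)
      then show ?thesis
        using s(4) by simp
    qed
    ultimately show ?thesis
      using that by blast
  qed
qed

text \<open>The element \<open>s + \<i> r\<close> is a scaled unitary.\<close>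

lemma norm_commuting_sum_squares:
  fixes s r :: "'a::cstar_algebra_1"
  assumes "star s = s" "star r = r" "s * r = r * s" "s * s + r * r = c *\<^sub>R 1"
  shows "(norm s)\<^sup>2 \<le> \<bar>c\<bar>"
proof -
  define u where "u = s + \<i> *\<^sub>C r"
  have su: "star u = s - \<i> *\<^sub>C r"
    using assms by (simp add: u_def star_add star_scaleC scaleC_minus_left)
  have "\<i> *\<^sub>C (\<i> *\<^sub>C (r * r)) = complex_of_real (- 1) *\<^sub>C (r * r)"
    by (simp add: scaleC_scaleC)
  then have ii: "\<i> *\<^sub>C (\<i> *\<^sub>C (r * r)) = - (r * r)"
    by (simp only: scaleC_of_real) simp
  have "star u * u = s * s + r * r"
    unfolding su unfolding u_def
    by (simp add: algebra_simps mult_scaleC_left mult_scaleC_right scaleC_diff_right scaleC_add_right ii assms)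
  then have "(norm u)\<^sup>2 = \<bar>c\<bar>"
    using norm_star_mult [of u] assms by simp
  moreover have "u + star u = 2 *\<^sub>R s"
    unfolding su unfolding u_def by (simp add: scaleR_2)
  then have "norm s \<le> norm u"
    using norm_triangle_ineq [of u "star u"] by simp
  then have "(norm s)\<^sup>2 \<le> (norm u)\<^sup>2"
    by (rule power_mono) simp
  ultimately show ?thesis
    by simp
qed

text \<open>The root \<open>r\<close> of \<open>1 - s * s\<close> commutes with \<open>s\<close>,
  and \<open>r * r + s * s = 1\<close>; hence \<open>norm r <= 1\<close>, and the C*-identity gives
  the claim.\<close>

lemma norm_one_minus_square:
  fixes s :: "'a::cstar_algebra_1"
  assumes "star s = s" "norm s \<le> 1"
  shows "norm (1 - s * s) \<le> 1"
proof -
  have "norm (s * s) \<le> 1"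
    using norm_star_mult [of s] assms power_le_one [of "norm s" 2] by simp
  moreover have "star (s * s) = s * s"
    by (simp add: star_mult assms)
  ultimately obtain r where r: "r * r = 1 - s * s" "star r = r"
    "\<forall>y. y * (s * s) = (s * s) * y \<longrightarrow> y * r = r * y"
    by (rule one_minus_sqrt)
  have "(norm r)\<^sup>2 \<le> \<bar>1\<bar>"
    by (rule norm_commuting_sum_squares [of r s]) (use assms r(1,2) r(3) [rule_format, of s] in \<open>simp_all add: mult.assoc\<close>)
  then show ?thesis
    using norm_star_mult [of r] r(1,2) by simp
qed

lemma norm_minus_square:
  fixes s :: "'a::cstar_algebra_1"
  assumes sa: "star s = s" and t: "(norm s)\<^sup>2 \<le> t"
  shows "norm (t *\<^sub>R 1 - s * s) \<le> t"
proof (cases "t = 0")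
  case True
  then show ?thesis using t by simp
next
  case False
  with t have t0: "t > 0"
    using zero_le_power2 [of "norm s"] by linarith
  define v where "v = inverse (sqrt t) *\<^sub>R s"
  have "norm s \<le> sqrt t"
    using t by (simp add: real_le_rsqrt)
  then have "norm v \<le> 1"
    using t0 by (simp add: v_def field_simps)
  then have "norm (1 - v * v) \<le> 1"
    by (intro norm_one_minus_square) (simp_all add: v_def star_scaleR sa)
  moreover have "t *\<^sub>R 1 - s * s = t *\<^sub>R (1 - v * v)"
    using t0 by (simp add: v_def scaleR_diff_right flip: inverse_mult_distrib)
  ultimately show ?thesis
    using t0 by simp
qed

lemma cpos_square: "star s = s \<Longrightarrow> cpos (s * s)"
  by (rule cposI [of _ "(norm s)\<^sup>2"]) (simp_all add: star_mult norm_minus_square)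

text \<open>Writing \<open>a\<close> as a square shows that every number from \<open>norm a\<close>
  on can serve as the witness in \<open>cpos\<close>.\<close>

lemma norm_minus_cpos:
  assumes "cpos a" "norm a \<le> t"
  shows "norm (t *\<^sub>R 1 - a) \<le> t"
proof -
  obtain s where s: "cpos s" "s * s = a"
    using assms(1) by (rule cpos_sqrt)
  then have "(norm s)\<^sup>2 = norm a"
    using norm_star_mult [of s] by (simp add: cpos_star)
  then show ?thesis
    using norm_minus_square [of s t] s assms by (simp add: cpos_star)
qed

lemma cpos_0 [simp]: "cpos 0"
  using cpos_square [of 0] by simp

lemma cpos_1 [simp]: "cpos 1"
  using cpos_square [of 1] by simp

text \<open>With positivity in norm form, the witnesses add up by the triangle inequality.\<close>

lemma cpos_add:
  assumes "cpos a" "cpos b"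
  shows "cpos (a + b)"
proof -
  from assms obtain s t where st: "s \<ge> 0" "norm (s *\<^sub>R 1 - a) \<le> s" "t \<ge> 0" "norm (t *\<^sub>R 1 - b) \<le> t"
    by (auto simp: cpos_def)
  have "norm ((s + t) *\<^sub>R 1 - (a + b)) \<le> norm (s *\<^sub>R 1 - a) + norm (t *\<^sub>R 1 - b)"
    using norm_triangle_ineq [of "s *\<^sub>R 1 - a" "t *\<^sub>R 1 - b"] by (simp add: algebra_simps)
  then have "norm ((s + t) *\<^sub>R 1 - (a + b)) \<le> s + t"
    using st by simp
  then show ?thesis
    using st assms by (intro cposI [of _ "s + t"]) (simp_all add: star_add cpos_star)
qed

text \<open>The roots \<open>s\<close> and \<open>r\<close> of \<open>a\<close> and \<open>b\<close>
  commute, so \<open>a * b\<close> is the square of the self-adjoint \<open>s * r\<close>.\<close>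

lemma cpos_commuting_mult:
  assumes "cpos a" "cpos b" "a * b = b * a"
  shows "cpos (a * b)"
proof -
  obtain s where s: "cpos s" "s * s = a" "\<forall>y. y * a = a * y \<longrightarrow> y * s = s * y"
    using assms(1) by (rule cpos_sqrt)
  obtain r where r: "cpos r" "r * r = b" "\<forall>y. y * b = b * y \<longrightarrow> y * r = r * y"
    using assms(2) by (rule cpos_sqrt)
  have "b * s = s * b"
    using s(3) [rule_format, of b] assms(3) by simp
  then have sr: "s * r = r * s"
    using r(3) [rule_format, of s] by simp
  have "a * b = s * (s * r) * r"
    by (simp add: mult.assoc flip: s(2) r(2))
  also have "\<dots> = s * (r * s) * r"
    by (simp only: sr)
  also have "\<dots> = (s * r) * (s * r)"
    by (simp only: mult.assoc)
  finally show ?thesis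
    using cpos_square [of "s * r"] by (simp add: star_mult cpos_star s(1) r(1) sr)
qed

lemma cpos_scaleR:
  assumes "cpos a" "r \<ge> 0"
  shows "cpos (r *\<^sub>R a)"
proof -
  have "cpos ((sqrt r *\<^sub>R 1) * (sqrt r *\<^sub>R (1::'a)))"
    by (rule cpos_square) (simp add: star_scaleR)
  then have "cpos (r *\<^sub>R (1::'a))"
    using assms by simp
  then show ?thesis
    using cpos_commuting_mult [OF _ assms(1), of "r *\<^sub>R 1"] by simp
qed

lemma cpos_scaleR_1: "r \<ge> 0 \<Longrightarrow> cpos (r *\<^sub>R 1)"
  by (simp add: cpos_scaleR)

lemma cpos_power: "cpos a \<Longrightarrow> cpos (a ^ n)"
  by (induction n) (simp_all add: cpos_commuting_mult power_commutes)

lemma cpos_norm_minus: "star a = a \<Longrightarrow> norm a \<le> t \<Longrightarrow> cpos (t *\<^sub>R 1 - a)"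
  using order_trans [OF norm_ge_zero, of a t]
  by (intro cposI [of _ t]) (simp_all add: star_diff star_scaleR)

text \<open>Commuting square roots of \<open>a\<close> and \<open>c - a\<close> have squares that
  sum to \<open>c\<close>, the situation of \<open>norm_commuting_sum_squares\<close>.\<close>

lemma cpos_norm_le:
  assumes "cpos a" "cpos (c *\<^sub>R 1 - a)"
  shows "norm a \<le> \<bar>c\<bar>"
proof -
  obtain s where s: "cpos s" "s * s = a" "\<forall>y. y * a = a * y \<longrightarrow> y * s = s * y"
    using assms(1) by (rule cpos_sqrt)
  obtain r where r: "cpos r" "r * r = c *\<^sub>R 1 - a"
    "\<forall>y. y * (c *\<^sub>R 1 - a) = (c *\<^sub>R 1 - a) * y \<longrightarrow> y * r = r * y"
    using assms(2) by (rule cpos_sqrt)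
  have "s * a = a * s"
    by (simp add: mult.assoc flip: s(2))
  then have "s * r = r * s"
    by (intro r(3) [rule_format]) (simp add: algebra_simps)
  then have "(norm s)\<^sup>2 \<le> \<bar>c\<bar>"
    by (intro norm_commuting_sum_squares [of s r]) (use s(1,2) r(1,2) in \<open>simp_all add: cpos_star\<close>)
  moreover have "(norm s)\<^sup>2 = norm a"
    using norm_star_mult [of s] s(1,2) by (simp add: cpos_star)
  ultimately show ?thesis
    by simp
qed

text \<open>Taking \<open>norm a\<close> itself as the witness makes positivity a closed
  condition.\<close>

lemma cpos_limit:
  assumes "\<And>n. cpos (f n)" "f \<longlonglongrightarrow> a"
  shows "cpos a"
proof -
  have "(\<lambda>n. star (f n)) \<longlonglongrightarrow> star a"
    by (rule tendsto_star [OF assms(2)])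
  then have "star a = a"
    using assms LIMSEQ_unique by (fastforce simp: cpos_star)
  moreover have "norm (norm a *\<^sub>R 1 - a) \<le> norm a"
  proof (rule LIMSEQ_le)
    show "(\<lambda>n. norm (norm (f n) *\<^sub>R 1 - f n)) \<longlonglongrightarrow> norm (norm a *\<^sub>R 1 - a)"
      by (intro tendsto_intros assms)
    show "(\<lambda>n. norm (f n)) \<longlonglongrightarrow> norm a"
      by (intro tendsto_intros assms)
    show "\<exists>N. \<forall>n\<ge>N. norm (norm (f n) *\<^sub>R 1 - f n) \<le> norm (f n)"
      using norm_minus_cpos assms by blast
  qed
  ultimately show ?thesis
    by (intro cposI [of _ "norm a"]) simp_all
qed

subsection \<open>Order and factorization\<close>

text \<open>Write \<open>c + q = (c + t) (1 - h)\<close> with \<open>t = norm q\<close> and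
  \<open>norm h <= t / (c + t) < 1\<close>, and invert \<open>1 - h\<close> by the Neumann series.
  The bound on \<open>norm h\<close> yields exactly \<open>norm r <= 1 / c\<close>.\<close>

lemma cpos_inverse:
  fixes q :: "'a::cstar_algebra_1"
  assumes q: "cpos q" and c: "c > 0"
  obtains r where "r * (c *\<^sub>R 1 + q) = 1" "(c *\<^sub>R 1 + q) * r = 1" "norm r \<le> 1 / c" "cpos r"
    "\<forall>y. y * q = q * y \<longrightarrow> y * r = r * y"
proof -
  define t where "t = norm q"
  have ct: "c + t > 0" "t \<ge> 0"
    using c by (simp_all add: t_def add_pos_nonneg)
  define h where "h = (1 / (c + t)) *\<^sub>R (t *\<^sub>R 1 - q)"
  have "norm h = norm (t *\<^sub>R 1 - q) / (c + t)"
    using ct by (simp add: h_def)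
  also have "\<dots> \<le> t / (c + t)"
    using norm_minus_cpos [OF q, of t] ct by (intro divide_right_mono) (simp_all add: t_def)
  finally have nh: "norm h \<le> t / (c + t)" .
  moreover have "t / (c + t) < 1"
    using c ct by simp
  ultimately have h1: "norm h < 1"
    by linarith
  define s where "s = (\<Sum>n. h ^ n)"
  have sm: "summable (\<lambda>n. h ^ n)"
    by (rule complete_algebra_summable_geometric [OF h1])
  have tail: "(\<Sum>n. h ^ Suc n) = s - 1"
    using suminf_split_head [OF sm] by (simp add: s_def)
  have hs: "h * s = s - 1"
    using suminf_mult [OF sm, of h] tail by (simp add: s_def)
  have sh: "s * h = s - 1"
    using suminf_mult2 [OF sm, of h] tail by (simp add: s_def power_commutes)
  have ns: "norm s \<le> 1 / (1 - norm h)"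
  proof -
    have sg: "summable (\<lambda>n. norm h ^ n)"
      using h1 by (intro summable_geometric) simp
    have sn: "summable (\<lambda>n. norm (h ^ n))"
      by (intro summable_comparison_test' [OF sg, of 0]) (simp add: norm_power_ineq)
    have "norm s \<le> (\<Sum>n. norm (h ^ n))"
      unfolding s_def by (rule summable_norm [OF sn])
    also have "\<dots> \<le> (\<Sum>n. norm h ^ n)"
      by (rule suminf_le [OF norm_power_ineq sn sg])
    also have "\<dots> = 1 / (1 - norm h)"
      using h1 by (intro suminf_geometric) simp
    finally show ?thesis .
  qed
  define r where "r = (1 / (c + t)) *\<^sub>R s"
  have cq: "c *\<^sub>R 1 + q = (c + t) *\<^sub>R (1 - h)"
    using ct by (simp add: h_def scaleR_diff_right scaleR_add_left)
  have r1: "r * (c *\<^sub>R 1 + q) = 1"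
  proof -
    have "s * (1 - h) = 1"
      by (simp add: right_diff_distrib sh)
    then show ?thesis
      unfolding cq r_def using ct by simp
  qed
  have r2: "(c *\<^sub>R 1 + q) * r = 1"
  proof -
    have "(1 - h) * s = 1"
      by (simp add: left_diff_distrib hs)
    then show ?thesis
      unfolding cq r_def using ct by simp
  qed
  have "c / (c + t) \<le> 1 - norm h"
    using nh ct c by (simp add: field_simps)
  then have "1 / (1 - norm h) \<le> 1 / (c / (c + t))"
    using c ct by (intro divide_left_mono) (simp_all add: h1)
  then have "norm s \<le> (c + t) / c"
    using ns by simp
  then have "norm r \<le> (1 / (c + t)) * ((c + t) / c)"
    unfolding r_def using ct by (auto intro!: divide_right_mono simp: divide_le_eq)
  then have r3: "norm r \<le> 1 / c"
    using ct c by simp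
  have comm: "y * r = r * y" if "y * q = q * y" for y
  proof -
    have y: "y * (c *\<^sub>R 1 + q) = (c *\<^sub>R 1 + q) * y"
      using that by (simp add: algebra_simps)
    have "y * r = r * (c *\<^sub>R 1 + q) * y * r"
      by (simp add: r1)
    also have "\<dots> = r * y * ((c *\<^sub>R 1 + q) * r)"
      by (simp add: mult.assoc flip: y)
    finally show ?thesis
      by (simp add: r2)
  qed
  have sq: "star (c *\<^sub>R 1 + q) = c *\<^sub>R 1 + q"
    using q by (simp add: star_add star_scaleR cpos_star)
  have "star r * (c *\<^sub>R 1 + q) = 1"
    using star_mult [of "c *\<^sub>R 1 + q" r] by (simp add: r2 sq)
  then have sr: "star r = r"
    using r2 by (metis mult.assoc mult_1_left mult_1_right)
  \<comment> \<open>Since \<open>r = r * r * (c + q)\<close>, positivity of \<open>r\<close> reduces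
    to a product of commuting positive elements.\<close>
  have "cpos (r * r * (c *\<^sub>R 1 + q))"
  proof (rule cpos_commuting_mult)
    show "cpos (c *\<^sub>R 1 + q)"
      using q c by (intro cpos_add cpos_scaleR_1) simp_all
    show "r * r * (c *\<^sub>R 1 + q) = (c *\<^sub>R 1 + q) * (r * r)"
      using r1 r2 by (simp add: mult.assoc) (simp flip: mult.assoc)
  qed (rule cpos_square [OF sr])
  then have "cpos r"
    by (simp add: mult.assoc r1)
  with that r1 r2 r3 comm show ?thesis
    by blast
qed

section \<open>Positivity of \<open>star x * x\<close>\<close>

text \<open>
  With \<open>p = - y\<^sup>* y\<close>, \<open>q = y y\<^sup>* \<ge> 0\<close> and \<open>c = \<parallel>p\<parallel>\<close>, the identity \<open>(c + q) y = y (c - p)\<close> gives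
  \<open>c \<parallel>y\<parallel> \<le> \<parallel>y (c - p)\<parallel>\<close>, whereas \<open>\<parallel>p (c - p)\<parallel> \<le> c\<^sup>2/4\<close>.
\<close>

lemma cpos_minus_star_mult_imp_0:
  fixes y :: "'a::cstar_algebra_1"
  assumes "cpos (- (star y * y))"
  shows "y = 0"
proof (rule ccontr)
  assume y0: "y \<noteq> 0"
  define p where "p = - (star y * y)"
  define q where "q = y * star y"
  define k where "k = \<i> *\<^sub>C (y - star y)"
  define c where "c = norm p"
  have p: "cpos p"
    using assms by (simp add: p_def)
  have c_y: "c = (norm y)\<^sup>2"
    by (simp add: c_def p_def norm_star_mult)
  with y0 have c: "c > 0"
    by simp
  have "star k = k"
    unfolding k_def star_scaleC by (simp add: star_diff star_star scaleC_minus_left scaleC_diff_right)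
  then have kk: "cpos (k * k)"
    by (rule cpos_square)
  have "k * k = complex_of_real (- 1) *\<^sub>C ((y - star y) * (y - star y))"
    by (simp add: k_def mult_scaleC_left mult_scaleC_right scaleC_scaleC)
  then have kk_eq: "k * k = - ((y - star y) * (y - star y))"
    unfolding scaleC_of_real by simp
  have "cpos ((y + star y) * (y + star y))"
    by (rule cpos_square) (simp add: star_add star_star add.commute)
  then have "cpos ((1/2) *\<^sub>R ((y + star y) * (y + star y) + k * k) + p)"
    using kk p by (intro cpos_add cpos_scaleR) simp_all
  moreover have "(y + star y) * (y + star y) + k * k = 2 *\<^sub>R (y * star y + star y * y)"
    unfolding kk_eq scaleR_2 by (simp add: algebra_simps)
  ultimately have q: "cpos q"
    by (simp add: q_def p_def)
  obtain r where r: "r * (c *\<^sub>R 1 + q) = 1" "norm r \<le> 1 / c"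
    using q c by (rule cpos_inverse)
  have swap: "(c *\<^sub>R 1 + q) * y = y * (c *\<^sub>R 1 - p)"
    by (simp add: q_def p_def algebra_simps mult.assoc)
  have "y = r * (c *\<^sub>R 1 + q) * y"
    by (simp add: r)
  also have "\<dots> = r * (y * (c *\<^sub>R 1 - p))"
    unfolding mult.assoc swap ..
  finally have "norm y \<le> norm r * norm (y * (c *\<^sub>R 1 - p))"
    by (metis norm_mult_ineq)
  also have "\<dots> \<le> (1 / c) * norm (y * (c *\<^sub>R 1 - p))"
    by (rule mult_right_mono [OF r(2)]) simp
  finally have "c * norm y \<le> norm (y * (c *\<^sub>R 1 - p))"
    using c by (simp add: field_simps)
  then have "(c * norm y)\<^sup>2 \<le> (norm (y * (c *\<^sub>R 1 - p)))\<^sup>2"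
    using c by (intro power_mono) simp_all
  moreover have "(c * norm y)\<^sup>2 = c * c * c"
    unfolding power_mult_distrib c_y [symmetric] by (simp add: power2_eq_square)
  ultimately have 1: "c * c * c \<le> (norm (y * (c *\<^sub>R 1 - p)))\<^sup>2"
    by simp
  have cp: "cpos (c *\<^sub>R 1 - p)"
    using p by (intro cpos_norm_minus) (simp_all add: cpos_star c_def)
  have cp': "cpos (p * (c *\<^sub>R 1 - p))"
    by (rule cpos_commuting_mult [OF p cp]) (simp add: algebra_simps)
  \<comment> \<open>Completing the square: \<open>p * (c - p) = c^2/4 - (p - c/2)^2\<close>.\<close>
  have "cpos ((p - (c/2) *\<^sub>R 1) * (p - (c/2) *\<^sub>R 1))"
    by (rule cpos_square) (simp add: star_diff star_scaleR p [THEN cpos_star])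
  moreover have "(p - (c/2) *\<^sub>R 1) * (p - (c/2) *\<^sub>R 1) = (c * c / 4) *\<^sub>R 1 - p * (c *\<^sub>R 1 - p)"
  proof -
    have "c *\<^sub>R p = (c/2) *\<^sub>R p + (c/2) *\<^sub>R p"
      by (simp flip: scaleR_add_left)
    then show ?thesis
      by (simp add: algebra_simps)
  qed
  ultimately have "cpos ((c * c / 4) *\<^sub>R 1 - p * (c *\<^sub>R 1 - p))"
    by simp
  then have np: "norm (p * (c *\<^sub>R 1 - p)) \<le> c * c / 4"
    using cpos_norm_le [OF cp', of "c * c / 4"] by simp
  \<comment> \<open>The C*-identity for \<open>y * (c - p)\<close> brings in
    \<open>star y * y = - p\<close>; the resulting upper bound \<open>c * c^2 / 4\<close>
    contradicts the lower bound \<open>c^3\<close>.\<close>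
  have "star (y * (c *\<^sub>R 1 - p)) * (y * (c *\<^sub>R 1 - p)) = - ((c *\<^sub>R 1 - p) * (p * (c *\<^sub>R 1 - p)))"
    unfolding star_mult cpos_star [OF cp] by (simp add: p_def mult.assoc)
  then have "(norm (y * (c *\<^sub>R 1 - p)))\<^sup>2 = norm ((c *\<^sub>R 1 - p) * (p * (c *\<^sub>R 1 - p)))"
    using norm_star_mult [of "y * (c *\<^sub>R 1 - p)"] by simp
  also have "\<dots> \<le> norm (c *\<^sub>R 1 - p) * norm (p * (c *\<^sub>R 1 - p))"
    by (rule norm_mult_ineq)
  also have "\<dots> \<le> c * (c * c / 4)"
    using norm_minus_cpos [OF p, of c] np c by (intro mult_mono) (simp_all add: c_def)
  finally have "c * c * c \<le> c * (c * c / 4)"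
    using 1 by linarith
  then show False
    using c by (simp add: field_simps)
qed

text \<open>Let \<open>m\<close> be the absolute value of \<open>a = star x * x\<close>, that is,
  the root of \<open>a * a\<close>, and let \<open>k = m - a\<close>, twice the negative part. Then
  \<open>a * k = - (k * m)\<close>, so \<open>- (star (x * k) * (x * k)) = k * k * m\<close> is
  positive and \<open>x * k = 0\<close>. This forces \<open>k = 0\<close>, hence
  \<open>a = m\<close>.\<close>

lemma cpos_star_mult: "cpos (star x * x)" for x :: "'a::cstar_algebra_1"
proof -
  define a where "a = star x * x"
  have sa: "star a = a"
    by (simp add: a_def star_mult star_star)
  obtain m where m: "cpos m" "m * m = a * a" "\<forall>y. y * (a * a) = (a * a) * y \<longrightarrow> y * m = m * y"
    using cpos_square [OF sa] by (rule cpos_sqrt)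
  have am: "a * m = m * a"
    using m(3) by (simp add: mult.assoc)
  define k where "k = m - a"
  have sk: "star k = k"
    by (simp add: k_def star_diff sa cpos_star m(1))
  have km: "k * m = m * k"
    by (simp add: k_def left_diff_distrib right_diff_distrib am)
  have ak: "a * k = - (k * m)"
    by (simp add: k_def left_diff_distrib right_diff_distrib am m(2))
  have "cpos ((k * k) * m)"
    using cpos_square [OF sk] m(1)
  proof (rule cpos_commuting_mult)
    have "k * k * m = k * (m * k)" by (simp only: mult.assoc km)
    also have "\<dots> = m * (k * k)" by (simp only: km flip: mult.assoc)
    finally show "k * k * m = m * (k * k)" .
  qed
  moreover have "star (x * k) * (x * k) = k * (a * k)"
    by (simp add: star_mult sk a_def mult.assoc)
  ultimately have "cpos (- (star (x * k) * (x * k)))"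
    by (simp add: ak mult.assoc)
  then have "x * k = 0"
    by (rule cpos_minus_star_mult_imp_0)
  then have ak0: "a * k = 0"
    by (simp add: a_def mult.assoc)
  then have mk0: "m * k = 0"
    using ak km by simp
  have "star k * k = m * k - a * k"
    unfolding sk by (simp add: k_def left_diff_distrib)
  then have "star k * k = 0"
    by (simp add: ak0 mk0)
  then have "k = 0"
    using norm_star_mult [of k] by simp
  then show ?thesis
    using m(1) by (simp add: k_def a_def)
qed

lemma cpos_mult_star: "cpos (x * star x)" for x :: "'a::cstar_algebra_1"
  using cpos_star_mult [of "star x"] by (simp add: star_star)

lemma cpos_conj:
  assumes "cpos a"
  shows "cpos (star x * a * x)"
proof -
  obtain s where s: "cpos s" "s * s = a"
    using assms by (rule cpos_sqrt)
  have "star x * a * x = star (s * x) * (s * x)"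
    by (simp add: star_mult cpos_star s(1) mult.assoc flip: s(2))
  then show ?thesis
    using cpos_star_mult [of "s * x"] by simp
qed

section \<open>Comparison of norms and of square roots\<close>

lemma cpos_diff_trans: "cpos (b - a) \<Longrightarrow> cpos (c - b) \<Longrightarrow> cpos (c - a)"
  using cpos_add [of "b - a" "c - b"] by simp

lemma cpos_norm_mono:
  assumes "cpos a" "cpos (b - a)"
  shows "norm a \<le> norm b"
proof -
  have "cpos b"
    using cpos_add [OF assms] by simp
  then have "cpos (norm b *\<^sub>R 1 - b)"
    by (intro cpos_norm_minus) (simp_all add: cpos_star)
  then show ?thesis
    using cpos_norm_le [OF assms(1), of "norm b"] cpos_diff_trans [OF assms(2)] by simp
qed

text \<open>Conjugate the inequality by \<open>d\<close> and take norms. An order bound on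
  \<open>star x * x\<close> thus controls every right multiple of \<open>x\<close>, which later
  yields Cauchy sequences.\<close>

lemma norm_mult_right_mono:
  fixes x y :: "'a::cstar_algebra_1"
  assumes "cpos (star y * y - star x * x)"
  shows "norm (x * d) \<le> norm (y * d)"
proof -
  have "cpos (star (y * d) * (y * d) - star (x * d) * (x * d))"
    using cpos_conj [OF assms, of d] by (simp add: star_mult mult.assoc right_diff_distrib left_diff_distrib)
  then have "norm (star (x * d) * (x * d)) \<le> norm (star (y * d) * (y * d))"
    by (rule cpos_norm_mono [OF cpos_star_mult])
  then show ?thesis
    unfolding norm_star_mult by (rule power2_le_imp_le) simp
qed

lemma norm_power_power2:
  fixes s :: "'a::cstar_algebra_1"
  assumes "star s = s"
  shows "norm (s ^ (2 ^ j)) = norm s ^ (2 ^ j)"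
proof (induction j)
  case (Suc j)
  have "s ^ 2 ^ Suc j = star (s ^ 2 ^ j) * s ^ 2 ^ j"
    by (simp add: star_power assms mult_2 flip: power_add)
  then show ?case
    using Suc norm_star_mult [of "s ^ 2 ^ j"] by (simp flip: power_mult add: mult.commute)
qed simp

text \<open>For self-adjoint \<open>s\<close> the norm is multiplicative along the exponents
  \<open>2 ^ n\<close>, so a norm above 1 makes the powers unbounded.\<close>

lemma norm_le_1_if_powers_bounded:
  fixes s :: "'a::cstar_algebra_1"
  assumes "star s = s" and K: "\<And>n. norm (s ^ n) \<le> K"
  shows "norm s \<le> 1"
proof (rule ccontr)
  assume "\<not> norm s \<le> 1"
  then obtain n where n: "K < norm s ^ n"
    using real_arch_pow [of "norm s" K] by auto
  also have "\<dots> \<le> norm s ^ (2 ^ n)"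
    using \<open>\<not> norm s \<le> 1\<close> less_exp [of n] by (intro power_increasing) simp_all
  also have "\<dots> \<le> K"
    using K [of "2 ^ n"] norm_power_power2 [OF assms(1), of n] by simp
  finally show False by simp
qed

text \<open>
  With \<open>F = f + \<epsilon>\<close>, the self-adjoint element \<open>F\<^sup>-\<^sup>1\<^sup>/\<^sup>2 e F\<^sup>-\<^sup>1\<^sup>/\<^sup>2\<close> is similar to the
  contraction \<open>F\<^sup>-\<^sup>1 e\<close>, hence has bounded powers and is itself a contraction.
\<close>

lemma cpos_diff_if_squares:
  fixes e f :: "'a::cstar_algebra_1"
  assumes e: "cpos e" and f: "cpos f" and ef: "cpos (f * f - e * e)"
  shows "cpos (f - e)"
proof -
  have step: "cpos (f + c *\<^sub>R 1 - e)" if c: "c > 0" for c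
  proof -
    define F where "F = c *\<^sub>R 1 + f"
    have F: "cpos F"
      unfolding F_def using f c by (intro cpos_add cpos_scaleR_1) simp_all
    obtain R where R: "R * F = 1" "F * R = 1" "cpos R" "\<forall>y. y * f = f * y \<longrightarrow> y * R = R * y"
      unfolding F_def using f c by (rule cpos_inverse)
    obtain m where m: "cpos m" "m * m = F" "\<forall>y. y * F = F * y \<longrightarrow> y * m = m * y"
      using F by (rule cpos_sqrt)
    have Rm: "R * m = m * R"
      using m(3) R(1,2) by simp
    define v where "v = m * R"
    have mv: "m * v = 1"
      using m(2) R(2) by (simp add: v_def flip: mult.assoc)
    have vm: "v * m = 1"
      using m(2) R(1) by (simp add: v_def Rm flip: mult.assoc) (simp add: Rm mult.assoc flip: Rm)
    have sv: "star v = v"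
      by (simp add: v_def star_mult cpos_star m(1) R(3) Rm)
    define s where "s = v * e * v"
    have ss: "star s = s"
      by (simp add: s_def star_mult sv cpos_star e mult.assoc)
    have "cpos (star F * F - star e * e)"
    proof -
      have "cpos ((f * f - e * e) + ((2 * c) *\<^sub>R f + (c * c) *\<^sub>R 1))"
        using f c ef by (intro cpos_add cpos_scaleR) simp_all
      moreover have "(f * f - e * e) + ((2 * c) *\<^sub>R f + (c * c) *\<^sub>R 1) = star F * F - star e * e"
        unfolding cpos_star [OF F] cpos_star [OF e] mult_2 scaleR_add_left
        by (simp add: F_def algebra_simps)
      ultimately show ?thesis by simp
    qed
    then have "norm (e * R) \<le> norm (F * R)"
      by (rule norm_mult_right_mono)
    then have "norm (e * R) \<le> 1"
      by (simp add: R(2))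
    moreover have "star (R * e) = e * R"
      by (simp add: star_mult cpos_star e R(3))
    then have "norm (R * e) = norm (e * R)"
      by (metis norm_star)
    ultimately have Re: "norm ((R * e) ^ n) \<le> 1" for n
      using norm_power_ineq [of "R * e" n] power_le_one [of "norm (R * e)" n] by simp
    have sn: "s ^ n = m * (R * e) ^ n * v" for n
    proof (induction n)
      case 0
      then show ?case by (simp add: mv)
    next
      case (Suc n)
      have "s ^ Suc n = m * (R * e) ^ n * v * s"
        by (simp only: power_Suc2 Suc)
      also have "\<dots> = m * (R * e) ^ n * (v * m) * R * e * v"
        by (simp only: s_def v_def mult.assoc)
      finally show ?case
        by (simp only: vm mult_1_right power_Suc2 mult.assoc)
    qed
    have "norm (s ^ n) \<le> norm m * 1 * norm v" for n
      unfolding sn by (intro order_trans [OF norm_mult_ineq] mult_mono Re) simp_all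
    then have "norm s \<le> 1"
      by (rule norm_le_1_if_powers_bounded [OF ss])
    then have "cpos (1 - s)"
      using cpos_norm_minus [OF ss, of 1] by simp
    then have "cpos (star m * (1 - s) * m)"
      by (rule cpos_conj)
    moreover have "star m * (1 - s) * m = F - (m * v) * e * (v * m)"
      unfolding cpos_star [OF m(1)] s_def m(2) [symmetric]
      by (simp add: right_diff_distrib left_diff_distrib mult.assoc)
    ultimately show ?thesis
      by (simp add: mv vm F_def add.commute)
  qed
  have "(\<lambda>n. f + inverse (real (Suc n)) *\<^sub>R 1 - e) \<longlonglongrightarrow> f + 0 *\<^sub>R 1 - e"
    by (intro tendsto_intros LIMSEQ_inverse_real_of_nat)
  then have "cpos (f + 0 *\<^sub>R 1 - e)"
    by (rule cpos_limit [rotated]) (intro step, simp)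
  then show ?thesis by simp
qed

section \<open>Division by powers of a positive element\<close>

text \<open>The inverse of \<open>b + 1/(n+1)\<close>, a substitute for an inverse of
  \<open>b\<close>. A choice operator fixes one sequence, so that limits along \<open>n\<close> can
  be taken.\<close>

definition approx_inv :: "'a::cstar_algebra_1 \<Rightarrow> nat \<Rightarrow> 'a" where
  "approx_inv b n = (SOME r. r * (inverse (real (Suc n)) *\<^sub>R 1 + b) = 1 \<and>
     (inverse (real (Suc n)) *\<^sub>R 1 + b) * r = 1 \<and> cpos r \<and> b * r = r * b)"

context
  fixes b :: "'a::cstar_algebra_1"
  assumes b: "cpos b"
begin

lemma approx_inv:
  shows approx_inv_left: "approx_inv b n * (inverse (real (Suc n)) *\<^sub>R 1 + b) = 1"
    and approx_inv_right: "(inverse (real (Suc n)) *\<^sub>R 1 + b) * approx_inv b n = 1"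
    and cpos_approx_inv: "cpos (approx_inv b n)"
    and approx_inv_commute: "b * approx_inv b n = approx_inv b n * b"
proof -
  have c: "inverse (real (Suc n)) > 0" by simp
  obtain r where "r * (inverse (real (Suc n)) *\<^sub>R 1 + b) = 1 \<and>
     (inverse (real (Suc n)) *\<^sub>R 1 + b) * r = 1 \<and> cpos r \<and> b * r = r * b"
    using cpos_inverse [OF b c] by (metis (no_types, lifting))
  from someI [of "\<lambda>r. r * (inverse (real (Suc n)) *\<^sub>R 1 + b) = 1 \<and>
     (inverse (real (Suc n)) *\<^sub>R 1 + b) * r = 1 \<and> cpos r \<and> b * r = r * b", OF this]
  show "approx_inv b n * (inverse (real (Suc n)) *\<^sub>R 1 + b) = 1"
    "(inverse (real (Suc n)) *\<^sub>R 1 + b) * approx_inv b n = 1"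
    "cpos (approx_inv b n)" "b * approx_inv b n = approx_inv b n * b"
    unfolding approx_inv_def by blast+
qed

text \<open>\<open>1 - b * approx_inv b n\<close> is a positive scalar times
  \<open>approx_inv b n\<close>, so \<open>b * approx_inv b n\<close> lies between 0 and 1.\<close>

lemma norm_mult_approx_inv: "norm (b * approx_inv b n) \<le> 1"
proof -
  have "cpos (inverse (real (Suc n)) *\<^sub>R approx_inv b n)"
    by (intro cpos_scaleR cpos_approx_inv) simp
  moreover have "1 *\<^sub>R 1 - b * approx_inv b n = inverse (real (Suc n)) *\<^sub>R approx_inv b n"
    using approx_inv_right [of n] by (simp add: distrib_right) (metis add_diff_cancel_right')
  ultimately have "cpos (1 *\<^sub>R 1 - b * approx_inv b n)"
    by simp
  with cpos_norm_le [of "b * approx_inv b n" 1] show ?thesis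
    by (simp add: cpos_commuting_mult b cpos_approx_inv approx_inv_commute)
qed

text \<open>The resolvent identity.\<close>

lemma approx_inv_diff:
  "approx_inv b n - approx_inv b m
     = (inverse (real (Suc m)) - inverse (real (Suc n))) *\<^sub>R (approx_inv b n * approx_inv b m)"
proof -
  have "approx_inv b n - approx_inv b m
      = approx_inv b n * ((inverse (real (Suc m)) *\<^sub>R 1 + b) * approx_inv b m)
        - (approx_inv b n * (inverse (real (Suc n)) *\<^sub>R 1 + b)) * approx_inv b m"
    by (simp only: approx_inv_left approx_inv_right mult_1_left mult_1_right)
  also have "\<dots> = (inverse (real (Suc m)) - inverse (real (Suc n))) *\<^sub>R (approx_inv b n * approx_inv b m)"
    by (simp add: distrib_left distrib_right scaleR_diff_left mult.assoc del: of_nat_Suc)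
  finally show ?thesis .
qed

lemma approx_inv_tendsto: "(\<lambda>n. b * (b * approx_inv b n)) \<longlonglongrightarrow> b"
proof (rule LIM_zero_cancel, rule tendsto_0_le [where K = 1])
  show "(\<lambda>n. inverse (real (Suc n))) \<longlonglongrightarrow> 0"
    by (rule LIMSEQ_inverse_real_of_nat)
  have "b * (b * approx_inv b n) - b = - (inverse (real (Suc n)) *\<^sub>R (b * approx_inv b n))" for n
  proof -
    have "b * approx_inv b n = 1 - inverse (real (Suc n)) *\<^sub>R approx_inv b n"
      using approx_inv_right [of n] by (simp add: distrib_right eq_diff_eq add.commute)
    then have "b * (b * approx_inv b n) = b * (1 - inverse (real (Suc n)) *\<^sub>R approx_inv b n)"
      by simp
    then show ?thesis
      by (simp add: right_diff_distrib)
  qed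
  then show "\<forall>\<^sub>F n in sequentially. norm (b * (b * approx_inv b n) - b)
      \<le> norm (inverse (real (Suc n))) * 1"
    using norm_mult_approx_inv by (intro always_eventually allI) (simp add: mult_left_le)
qed

text \<open>All factors commute, so this is \<open>b ^ k\<close> times the square of
  \<open>b * b * approx_inv b n\<close>, which tends to \<open>b\<close>. Compression by the
  resolvents thus lowers an exponent by 2 in the limit.\<close>

lemma power_approx_inv_tendsto:
  "(\<lambda>n. approx_inv b n * b ^ (k + 4) * approx_inv b n) \<longlonglongrightarrow> b ^ (k + 2)"
proof -
  have "approx_inv b n * b ^ (k + 4) * approx_inv b n
      = b ^ k * (b * (b * approx_inv b n)) * (b * (b * approx_inv b n))" for n
  proof -
    have c: "approx_inv b n * b ^ j = b ^ j * approx_inv b n" for j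
      using power_commuting_commutes [OF approx_inv_commute [of n], of j] by simp
    have "b ^ (k + 4) = b ^ ((k + 2) + 2)"
      by (rule arg_cong [where f = "(^) b"]) simp
    also have "\<dots> = b ^ (k + 2) * (b * b)"
      unfolding power_add [of b "k + 2" 2] power2_eq_square ..
    finally have "approx_inv b n * b ^ (k + 4) * approx_inv b n
        = (approx_inv b n * b ^ (k + 2)) * (b * (b * approx_inv b n))"
      by (simp add: mult.assoc)
    also have "\<dots> = b ^ k * (b * (b * approx_inv b n)) * (b * (b * approx_inv b n))"
      unfolding c [of "k + 2"] unfolding power_add [of b k 2] power2_eq_square by (simp only: mult.assoc)
    finally show ?thesis .
  qed
  moreover have "(\<lambda>n. b ^ k * (b * (b * approx_inv b n)) * (b * (b * approx_inv b n)))
      \<longlonglongrightarrow> b ^ k * b * b"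
    by (intro tendsto_intros approx_inv_tendsto)
  ultimately show ?thesis
    unfolding power_add [of b k 2] power2_eq_square by (simp only: mult.assoc)
qed

text \<open>The limit \<open>w\<close> plays the role of \<open>x\<close> times the inverse of
  \<open>b\<close>. The hypothesis gives \<open>norm (x * d) <= sqrt C * norm (b * b * d)\<close>;
  for \<open>d\<close> a difference of two resolvents, the resolvent identity leaves two
  contractions times the difference of the shifts, so the sequence is Cauchy. The limit is part of
  the conclusion because further relations are carried through it.\<close>

lemma approx_inv_factor_4:
  assumes C: "C \<ge> 0" and x: "cpos (C *\<^sub>R b ^ 4 - star x * x)"
  obtains w where "(\<lambda>n. x * approx_inv b n) \<longlonglongrightarrow> w" "w * b = x"
proof -
  define y where "y = sqrt C *\<^sub>R (b * b)"
  have "star y * y = C *\<^sub>R b ^ 4"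
    using C by (simp add: y_def star_scaleR star_mult cpos_star b numeral_eq_Suc mult.assoc)
  then have nx: "norm (x * d) \<le> sqrt C * norm (b * b * d)" for d
    using norm_mult_right_mono [of y x d] x C by (simp add: y_def)
  define \<epsilon> where "\<epsilon> n = inverse (real (Suc n))" for n
  have \<epsilon>: "\<epsilon> \<longlonglongrightarrow> 0"
    unfolding \<epsilon>_def by (rule LIMSEQ_inverse_real_of_nat)
  have d: "dist (x * approx_inv b n) (x * approx_inv b m) \<le> sqrt C * dist (\<epsilon> n) (\<epsilon> m)" for n m
  proof -
    have "b * b * (approx_inv b n * approx_inv b m) = b * (approx_inv b n * b) * approx_inv b m"
      unfolding approx_inv_commute [of n, symmetric] by (simp only: mult.assoc)
    then have "b * b * (approx_inv b n - approx_inv b m)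
        = (\<epsilon> m - \<epsilon> n) *\<^sub>R ((b * approx_inv b n) * (b * approx_inv b m))"
      unfolding approx_inv_diff \<epsilon>_def
      by (simp add: mult.assoc)
    then have "norm (b * b * (approx_inv b n - approx_inv b m))
        = \<bar>\<epsilon> m - \<epsilon> n\<bar> * norm ((b * approx_inv b n) * (b * approx_inv b m))"
      by simp
    also have "\<dots> \<le> \<bar>\<epsilon> m - \<epsilon> n\<bar> * (1 * 1)"
      by (intro mult_left_mono order_trans [OF norm_mult_ineq] mult_mono norm_mult_approx_inv) simp_all
    finally have "norm (b * b * (approx_inv b n - approx_inv b m)) \<le> dist (\<epsilon> n) (\<epsilon> m)"
      by (simp add: dist_real_def abs_minus_commute)
    then have "sqrt C * norm (b * b * (approx_inv b n - approx_inv b m)) \<le> sqrt C * dist (\<epsilon> n) (\<epsilon> m)"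
      using C by (intro mult_left_mono) simp_all
    then show ?thesis
      using nx [of "approx_inv b n - approx_inv b m"] by (simp add: dist_norm right_diff_distrib)
  qed
  have "Cauchy (\<lambda>n. x * approx_inv b n)"
  proof (rule metric_CauchyI)
    fix e :: real assume e: "e > 0"
    have "Cauchy \<epsilon>"
      using \<epsilon> by (rule LIMSEQ_imp_Cauchy)
    \<comment> \<open>The summand 1 keeps the denominator positive when
      \<open>C = 0\<close>.\<close>
    then obtain M where M: "\<And>m n. m \<ge> M \<Longrightarrow> n \<ge> M \<Longrightarrow> dist (\<epsilon> m) (\<epsilon> n) < e / (sqrt C + 1)"
      using metric_CauchyD [of \<epsilon> "e / (sqrt C + 1)"] e C by (auto simp: add_nonneg_pos)
    have "dist (x * approx_inv b m) (x * approx_inv b n) < e" if "m \<ge> M" "n \<ge> M" for m n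
    proof -
      have "sqrt C * dist (\<epsilon> m) (\<epsilon> n) \<le> (sqrt C + 1) * dist (\<epsilon> m) (\<epsilon> n)"
        by (intro mult_right_mono) simp_all
      also have "\<dots> < e"
        using M [OF that] C by (simp add: pos_less_divide_eq add_nonneg_pos mult.commute)
      finally show ?thesis
        using d [of m n] by simp
    qed
    then show "\<exists>M. \<forall>m\<ge>M. \<forall>n\<ge>M. dist (x * approx_inv b m) (x * approx_inv b n) < e"
      by blast
  qed
  then obtain w where w: "(\<lambda>n. x * approx_inv b n) \<longlonglongrightarrow> w"
    using Cauchy_convergent convergent_def by blast
  have "(\<lambda>n. x * approx_inv b n * b) \<longlonglongrightarrow> w * b"
    by (intro tendsto_intros w)
  moreover have "(\<lambda>n. x * approx_inv b n * b) \<longlonglongrightarrow> x"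
  proof (rule LIM_zero_cancel, rule tendsto_0_le [where K = "sqrt C * norm b"])
    show "\<epsilon> \<longlonglongrightarrow> 0" by (rule \<epsilon>)
    have "norm (x * approx_inv b n * b - x) \<le> \<epsilon> n * (sqrt C * norm b)" for n
    proof -
      have "x * (approx_inv b n * (\<epsilon> n *\<^sub>R 1 + b)) = x"
        unfolding \<epsilon>_def approx_inv_left by simp
      moreover have "x * (approx_inv b n * (\<epsilon> n *\<^sub>R 1 + b))
          = \<epsilon> n *\<^sub>R (x * approx_inv b n) + x * approx_inv b n * b"
        by (simp add: distrib_left mult.assoc)
      moreover have "B - X = - A" if "Y = X" "Y = A + B" for A B X Y :: 'a
        using that by (auto simp: algebra_simps)
      ultimately have "x * approx_inv b n * b - x = - (\<epsilon> n *\<^sub>R (x * approx_inv b n))"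
        by blast
      then have "norm (x * approx_inv b n * b - x) = \<epsilon> n * norm (x * approx_inv b n)"
        by (simp add: \<epsilon>_def)
      also have "\<dots> \<le> \<epsilon> n * (sqrt C * norm (b * (b * approx_inv b n)))"
        using nx [of "approx_inv b n"] by (intro mult_left_mono) (simp_all add: \<epsilon>_def mult.assoc)
      also have "\<dots> \<le> \<epsilon> n * (sqrt C * (norm b * 1))"
        using C by (intro mult_left_mono order_trans [OF norm_mult_ineq] norm_mult_approx_inv)
          (simp_all add: \<epsilon>_def)
      finally show ?thesis by simp
    qed
    then show "\<forall>\<^sub>F n in sequentially. norm (x * approx_inv b n * b - x) \<le> norm (\<epsilon> n) * (sqrt C * norm b)"
      by (intro always_eventually allI) (simp add: \<epsilon>_def)
  qed
  ultimately have "w * b = x"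
    by (rule LIMSEQ_unique)
  with w that show ?thesis by blast
qed

text \<open>The bound \<open>b ^ (2 * k + 4) <= norm (b ^ (2 * k)) * b ^ 4\<close> reduces the
  factorization to \<open>approx_inv_factor_4\<close>. Conjugating the hypothesis by the resolvents
  and passing to the limit gives a bound of the same shape for \<open>w\<close>, so the step can be
  iterated.\<close>

lemma cpos_factor_step:
  assumes C: "C \<ge> 0" and x: "cpos (C *\<^sub>R b ^ (2 * k + 4) - star x * x)"
  obtains w where "w * b = x" "cpos (C *\<^sub>R b ^ (2 * k + 2) - star w * w)"
proof -
  define N where "N = norm (b ^ (2 * k))"
  have CN: "C * N \<ge> 0"
    using C by (simp add: N_def)
  have "cpos (b ^ 4 * (N *\<^sub>R 1 - b ^ (2 * k)))"
  proof (rule cpos_commuting_mult)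
    show "cpos (N *\<^sub>R 1 - b ^ (2 * k))"
      by (intro cpos_norm_minus cpos_star cpos_power b) (simp add: N_def)
  qed (simp_all add: cpos_power b algebra_simps flip: power_add)
  then have "cpos (C *\<^sub>R (b ^ 4 * (N *\<^sub>R 1 - b ^ (2 * k))))"
    using C by (rule cpos_scaleR)
  moreover have "C *\<^sub>R (b ^ 4 * (N *\<^sub>R 1 - b ^ (2 * k))) = (C * N) *\<^sub>R b ^ 4 - C *\<^sub>R b ^ (2 * k + 4)"
    by (simp add: right_diff_distrib scaleR_diff_right add.commute flip: power_add)
  ultimately have "cpos ((C * N) *\<^sub>R b ^ 4 - star x * x)"
    using cpos_diff_trans [OF x] by simp
  with CN obtain w where w: "(\<lambda>n. x * approx_inv b n) \<longlonglongrightarrow> w" "w * b = x"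
    by (rule approx_inv_factor_4)
  have "cpos (C *\<^sub>R b ^ (2 * k + 2) - star w * w)"
  proof (rule cpos_limit)
    show "(\<lambda>n. C *\<^sub>R (approx_inv b n * b ^ (2 * k + 4) * approx_inv b n)
        - star (x * approx_inv b n) * (x * approx_inv b n)) \<longlonglongrightarrow> C *\<^sub>R b ^ (2 * k + 2) - star w * w"
      by (intro tendsto_intros power_approx_inv_tendsto tendsto_star w)
    show "cpos (C *\<^sub>R (approx_inv b n * b ^ (2 * k + 4) * approx_inv b n)
        - star (x * approx_inv b n) * (x * approx_inv b n))" for n
      using cpos_conj [OF x, of "approx_inv b n"]
      by (simp add: star_mult cpos_star cpos_approx_inv mult.assoc right_diff_distrib left_diff_distrib)
  qed
  with w that show ?thesis by blast
qed

text \<open>Each step splits off one \<open>b\<close> on the right and lowers the exponent of the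
  bound by 2; it needs an exponent of at least 4, hence the \<open>2 * k + 2\<close> for
  \<open>k\<close> factors.\<close>

lemma cpos_factor:
  assumes C: "C \<ge> 0" and x: "cpos (C *\<^sub>R b ^ (2 * k + 2) - star x * x)"
  shows "\<exists>u. x = u * b ^ k"
  using x
proof (induction k arbitrary: x)
  case (Suc k)
  then have "cpos (C *\<^sub>R b ^ (2 * k + 4) - star x * x)"
    by (simp add: numeral_eq_Suc)
  with C obtain w where w: "w * b = x" "cpos (C *\<^sub>R b ^ (2 * k + 2) - star w * w)"
    by (rule cpos_factor_step)
  from Suc.IH [OF w(2)] obtain u where "w = u * b ^ k" ..
  then have "x = u * b ^ Suc k"
    using w(1) by (simp add: mult.assoc power_commutes)
  then show ?case ..
qed simp

end

subsection \<open>Idempotent ideals of unital algebras\<close>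

lemma two_sided_ideal_diff:
  assumes "two_sided_ideal J" "x \<in> J" "y \<in> J"
  shows "x - y \<in> J"
proof -
  have "x + - y \<in> J"
    using assms unfolding two_sided_ideal_def by blast
  then show ?thesis by simp
qed

lemma group_closure_subset_ideal:
  assumes J: "two_sided_ideal J" and S: "S \<subseteq> J"
  shows "group_closure S \<subseteq> J"
proof
  fix x assume "x \<in> group_closure S"
  then show "x \<in> J"
  proof induction
    case (base s)
    then show ?case
      using J S by (auto simp: two_sided_ideal_def)
  qed (rule two_sided_ideal_diff [OF J])
qed

definition principal_ideal :: "'a::ring_1 \<Rightarrow> 'a set" where
  "principal_ideal c = group_closure {p * c * q | p q. True}"

lemma principal_ideal_generator: "p * c * q \<in> principal_ideal c"
  unfolding principal_ideal_def by (rule group_closure.base) blast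

lemma principal_ideal_generator_left: "p * c \<in> principal_ideal c"
  using principal_ideal_generator [of p c 1] by simp

lemma principal_ideal_diff: "x \<in> principal_ideal c \<Longrightarrow> y \<in> principal_ideal c \<Longrightarrow> x - y \<in> principal_ideal c"
  unfolding principal_ideal_def by (rule group_closure.diff)

lemma principal_ideal_add: "x \<in> principal_ideal c \<Longrightarrow> y \<in> principal_ideal c \<Longrightarrow> x + y \<in> principal_ideal c"
  unfolding principal_ideal_def by (rule group_closure_add)

lemma principal_ideal_mult:
  assumes "x \<in> principal_ideal c"
  shows "a * x * b \<in> principal_ideal c"
  using assms unfolding principal_ideal_def
proof induction
  case (base s)
  then consider "s = 0" | p q where "s = p * c * q"
    by blast
  then show ?case
  proof cases
    case 2
    then have "a * s * b = (a * p) * c * (q * b)"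
      by (simp only: mult.assoc)
    then show ?thesis
      by (auto intro!: group_closure.base)
  qed simp
next
  case (diff s t)
  then show ?case
    using group_closure.diff by (fastforce simp: left_diff_distrib right_diff_distrib)
qed

lemma two_sided_ideal_principal_ideal: "two_sided_ideal (principal_ideal c)"
  unfolding two_sided_ideal_def
proof (intro conjI allI ballI)
  fix a x assume x: "x \<in> principal_ideal c"
  show "a * x \<in> principal_ideal c" "x * a \<in> principal_ideal c"
    using principal_ideal_mult [OF x, of a 1] principal_ideal_mult [OF x, of 1 a] by simp_all
  show "- x \<in> principal_ideal c"
    using principal_ideal_mult [OF x, of "- 1" 1] by simp
qed (simp add: principal_ideal_def, blast intro: principal_ideal_add)

lemma principal_ideal_subset: "two_sided_ideal J \<Longrightarrow> c \<in> J \<Longrightarrow> principal_ideal c \<subseteq> J"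
  unfolding principal_ideal_def
  by (rule group_closure_subset_ideal) (auto simp: two_sided_ideal_def)

lemma principal_ideal_power_antimono: "m \<le> n \<Longrightarrow> principal_ideal (b ^ n) \<subseteq> principal_ideal (b ^ m)"
  by (rule principal_ideal_subset [OF two_sided_ideal_principal_ideal])
    (metis le_add_diff_inverse2 power_add principal_ideal_generator_left)

lemma principal_ideal_scaleC:
  fixes c :: "'a::cstar_algebra_1"
  shows "x \<in> principal_ideal c \<Longrightarrow> z *\<^sub>C x \<in> principal_ideal c"
  using principal_ideal_mult [of x c "z *\<^sub>C 1" 1] by (simp add: mult_scaleC_left)

text \<open>The element is at most \<open>norm a * b ^ (2 * k + 2)\<close>, so its square root is
  \<open>u * b ^ k\<close> by \<open>cpos_factor\<close>, and also \<open>b ^ k * star u\<close> by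
  taking adjoints; multiply the two.\<close>

lemma cpos_sandwich_in_principal_ideal:
  assumes b: "cpos b" and a: "cpos a"
  shows "b ^ Suc k * a * b ^ Suc k \<in> principal_ideal (b ^ (2 * k))"
proof -
  define e where "e = b ^ Suc k * a * b ^ Suc k"
  have sb: "star (b ^ Suc k) = b ^ Suc k"
    by (intro cpos_star cpos_power b)
  have "cpos e"
    using cpos_conj [OF a, of "b ^ Suc k"] unfolding sb e_def .
  then obtain s where s: "cpos s" "s * s = e"
    by (rule cpos_sqrt)
  have "cpos (norm a *\<^sub>R 1 - a)"
    by (intro cpos_norm_minus cpos_star a) simp
  then have "cpos (b ^ Suc k * (norm a *\<^sub>R 1 - a) * b ^ Suc k)"
    using cpos_conj [of _ "b ^ Suc k"] unfolding sb by blast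
  moreover have "b ^ Suc k * (norm a *\<^sub>R 1 - a) * b ^ Suc k = norm a *\<^sub>R b ^ (2 * k + 2) - e"
  proof -
    have "b ^ Suc k * b ^ Suc k = b ^ (2 * k + 2)"
      unfolding power_add [symmetric] by (rule arg_cong [where f = "(^) b"]) simp
    then show ?thesis
      unfolding e_def right_diff_distrib left_diff_distrib
      by (simp only: mult_scaleR_left mult_scaleR_right mult_1_right)
  qed
  ultimately have "cpos (norm a *\<^sub>R b ^ (2 * k + 2) - star s * s)"
    by (simp add: s(2) cpos_star s(1))
  then obtain u where "s = u * b ^ k"
    using cpos_factor [OF b norm_ge_zero] by blast
  moreover from this have "s = b ^ k * star u"
    using cpos_star [OF s(1)] by (simp add: star_mult star_power cpos_star b)
  ultimately have "e = u * (b ^ k * b ^ k) * star u"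
    unfolding s(2) [symmetric] by (metis mult.assoc)
  then have "e = u * b ^ (2 * k) * star u"
    by (simp add: mult_2 power_add)
  then show ?thesis
    unfolding e_def [symmetric] by (simp only: principal_ideal_generator)
qed

text \<open>Every \<open>w\<close> is a complex combination of two self-adjoint elements, and a
  self-adjoint \<open>h\<close> is the difference of the positive elements \<open>norm h\<close> and
  \<open>norm h - h\<close>.\<close>

lemma sandwich_in_principal_ideal:
  assumes b: "cpos b"
  shows "b ^ Suc k * w * b ^ Suc k \<in> principal_ideal (b ^ (2 * k))"
proof -
  have sa: "b ^ Suc k * h * b ^ Suc k \<in> principal_ideal (b ^ (2 * k))" if "star h = h" for h
  proof -
    have "cpos (norm h *\<^sub>R 1 - h)"
      using that by (intro cpos_norm_minus) simp_all
    then have "b ^ Suc k * (norm h *\<^sub>R 1) * b ^ Suc k - b ^ Suc k * (norm h *\<^sub>R 1 - h) * b ^ Suc k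
        \<in> principal_ideal (b ^ (2 * k))"
      by (intro principal_ideal_diff cpos_sandwich_in_principal_ideal [OF b] cpos_scaleR_1) simp_all
    moreover have "b ^ Suc k * (norm h *\<^sub>R 1) * b ^ Suc k - b ^ Suc k * (norm h *\<^sub>R 1 - h) * b ^ Suc k
        = b ^ Suc k * h * b ^ Suc k"
      unfolding right_diff_distrib left_diff_distrib by simp
    ultimately show ?thesis by simp
  qed
  define h where "h = (1/2) *\<^sub>R (w + star w)"
  define l where "l = \<i> *\<^sub>C (w - star w)"
  have h: "star h = h"
    by (simp add: h_def star_scaleR star_add star_star add.commute)
  have l: "star l = l"
    unfolding l_def star_scaleC by (simp add: star_diff star_star scaleC_minus_left scaleC_diff_right)
  have "(- \<i> / 2) *\<^sub>C l = complex_of_real (1 / 2) *\<^sub>C (w - star w)"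
    unfolding l_def scaleC_scaleC by simp
  then have "(- \<i> / 2) *\<^sub>C l = (1 / 2) *\<^sub>R (w - star w)"
    by (simp only: scaleC_of_real)
  then have "h + (- \<i> / 2) *\<^sub>C l = (1/2) *\<^sub>R w + (1/2) *\<^sub>R w"
    by (simp add: h_def scaleR_add_right scaleR_diff_right)
  then have w: "w = h + (- \<i> / 2) *\<^sub>C l"
    by (simp flip: scaleR_add_left)
  have "b ^ Suc k * w * b ^ Suc k
      = b ^ Suc k * h * b ^ Suc k + (- \<i> / 2) *\<^sub>C (b ^ Suc k * l * b ^ Suc k)"
    by (subst w) (simp only: distrib_left distrib_right mult_scaleC_left mult_scaleC_right)
  then show ?thesis
    using principal_ideal_add [OF sa [OF h] principal_ideal_scaleC [OF sa [OF l]]] by simp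
qed

text \<open>The middle of a product of two generators is a sandwich
  \<open>b ^ Suc k * (q * p') * b ^ Suc k\<close>. The exponent passes from \<open>n\<close> to
  \<open>2 * n - 2\<close>, a gain as soon as \<open>n >= 3\<close>.\<close>

lemma principal_ideal_power_mult:
  assumes b: "cpos b" and x: "x \<in> principal_ideal (b ^ Suc k)" and y: "y \<in> principal_ideal (b ^ Suc k)"
  shows "x * y \<in> principal_ideal (b ^ (2 * k))"
proof -
  have pq: "(p * b ^ Suc k * q) * y \<in> principal_ideal (b ^ (2 * k))" for p q
    using y unfolding principal_ideal_def [of "b ^ Suc k"]
  proof induction
    case (base s)
    then consider "s = 0" | p' q' where "s = p' * b ^ Suc k * q'"
      by blast
    then show ?case
    proof cases
      case 2
      then have "p * b ^ Suc k * q * s = p * (b ^ Suc k * (q * p') * b ^ Suc k) * q'"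
        by (simp only: mult.assoc)
      then show ?thesis
        using principal_ideal_mult [OF sandwich_in_principal_ideal [OF b]] by simp
    qed (simp add: principal_ideal_def)
  next
    case (diff s t)
    then show ?case
      using principal_ideal_diff by (fastforce simp: right_diff_distrib)
  qed
  show ?thesis
    using x unfolding principal_ideal_def [of "b ^ Suc k"]
  proof induction
    case (base s)
    then show ?case
      using pq by (auto simp: principal_ideal_def)
  next
    case (diff s t)
    then show ?case
      using principal_ideal_diff by (fastforce simp: left_diff_distrib)
  qed
qed

lemma cpos_sum: "(\<And>x. x \<in> F \<Longrightarrow> cpos (f x)) \<Longrightarrow> cpos (sum f F)"
  by (induction F rule: infinite_finite_induct) (simp_all add: cpos_add)

lemma cpos_eighth_root:
  assumes "cpos c"
  obtains b where "cpos b" "b ^ 8 = c"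
proof -
  obtain s where s: "cpos s" "s * s = c"
    using assms by (rule cpos_sqrt)
  obtain t where t: "cpos t" "t * t = s"
    using s(1) by (rule cpos_sqrt)
  obtain b where b: "cpos b" "b * b = t"
    using t(1) by (rule cpos_sqrt)
  have "b ^ 8 = (b * b) * (b * b) * ((b * b) * (b * b))"
    by (simp add: numeral_eq_Suc mult.assoc)
  then show ?thesis
    using that [OF b(1)] b(2) t(2) s(2) by simp
qed

text \<open>Take \<open>b\<close> as the eighth root of the sum of all \<open>star x * x\<close>.
  Each summand is at most \<open>b ^ 8\<close>, and \<open>8 = 2 * 3 + 2\<close>, so
  \<open>cpos_factor\<close> splits off \<open>b ^ 3\<close>; 3 is the least exponent that grows
  under multiplication.\<close>

lemma ideal_finite_subset_principal_ideal_3: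
  assumes J: "two_sided_ideal J" and F: "finite F" "F \<subseteq> J"
  obtains b :: "'a::cstar_algebra_1" where "cpos b" "b ^ 8 \<in> J" "F \<subseteq> principal_ideal (b ^ 3)"
proof -
  define c where "c = (\<Sum>x\<in>F. star x * x)"
  have "cpos c"
    unfolding c_def by (intro cpos_sum cpos_star_mult)
  then obtain b where b: "cpos b" "b ^ 8 = c"
    by (rule cpos_eighth_root)
  have "c \<in> J"
    unfolding c_def using F
    by (induction F rule: finite_induct) (use J in \<open>auto simp: two_sided_ideal_def\<close>)
  moreover have "x \<in> principal_ideal (b ^ 3)" if x: "x \<in> F" for x
  proof -
    have "c - star x * x = (\<Sum>x\<in>F - {x}. star x * x)"
      unfolding c_def using F(1) x by (simp add: sum.remove)
    moreover have "cpos (\<Sum>x\<in>F - {x}. star x * x)"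
      by (intro cpos_sum cpos_star_mult)
    ultimately have "cpos (c - star x * x)"
      by simp
    then have "cpos (1 *\<^sub>R b ^ (2 * 3 + 2) - star x * x)"
      by (simp add: b(2))
    from cpos_factor [OF b(1) zero_le_one this]
    obtain u where "x = u * b ^ 3" ..
    then show ?thesis
      by (simp add: principal_ideal_generator_left)
  qed
  ultimately show ?thesis
    using that b by blast
qed

text \<open>Only finitely many factors occur in one element; collecting them lets a single
  \<open>b\<close> serve for all.\<close>

lemma group_closure_products_finite:
  assumes "x \<in> group_closure {y * z | y z. y \<in> J \<and> z \<in> J}"
  shows "\<exists>F. finite F \<and> F \<subseteq> J \<and> x \<in> group_closure {y * z | y z. y \<in> F \<and> z \<in> F}"
  using assms
proof induction
  case (base s)
  then consider "s = 0" | y z where "s = y * z" "y \<in> J" "z \<in> J"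
    by blast
  then show ?case
  proof cases
    case 1
    then show ?thesis
      by (intro exI [of _ "{}"]) simp
  next
    case 2
    then show ?thesis
      by (intro exI [of _ "{y, z}"]) (auto intro!: group_closure.base)
  qed
next
  case (diff s t)
  then obtain F G where FG: "finite F" "F \<subseteq> J" "finite G" "G \<subseteq> J"
    "s \<in> group_closure {y * z | y z. y \<in> F \<and> z \<in> F}"
    "t \<in> group_closure {y * z | y z. y \<in> G \<and> z \<in> G}"
    by blast
  have mono: "group_closure S \<subseteq> group_closure T" if "S \<subseteq> T" for S T :: "'a set"
  proof
    fix x assume "x \<in> group_closure S"
    then show "x \<in> group_closure T"
      by induction (use that in \<open>auto intro: group_closure.intros\<close>)
  qed
  have "s \<in> group_closure {y * z | y z. y \<in> F \<union> G \<and> z \<in> F \<union> G}"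
    using FG(5) by (rule subsetD [OF mono, rotated]) blast
  moreover have "t \<in> group_closure {y * z | y z. y \<in> F \<union> G \<and> z \<in> F \<union> G}"
    using FG(6) by (rule subsetD [OF mono, rotated]) blast
  ultimately show ?case
    using FG(1-4) by (intro exI [of _ "F \<union> G"]) (auto intro: group_closure.diff)
qed

text \<open>The elements of \<open>F\<close> are sums of products from a finite subset of
  \<open>J\<close>; the induction hypothesis applies to that subset, and multiplying raises the
  exponent. The element \<open>b\<close> changes from step to step, while
  \<open>b ^ 8 \<in> J\<close> persists.\<close>

lemma idempotent_ideal_finite_subset_principal_ideal:
  fixes J :: "'a::cstar_algebra_1 set"
  assumes J: "two_sided_ideal J" and idem: "J \<subseteq> group_closure {y * z | y z. y \<in> J \<and> z \<in> J}"
    and "finite F" "F \<subseteq> J"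
  shows "\<exists>b. cpos b \<and> b ^ 8 \<in> J \<and> F \<subseteq> principal_ideal (b ^ n)"
  using assms(3,4)
proof (induction n arbitrary: F)
  case 0
  then show ?case
  proof -
    obtain b where "cpos b" "b ^ 8 \<in> J" "F \<subseteq> principal_ideal (b ^ 3)"
      using J 0 by (rule ideal_finite_subset_principal_ideal_3)
    then show ?thesis
      using principal_ideal_power_antimono [of 0 3 b] by blast
  qed
next
  case (Suc n)
  show ?case
  proof (cases "Suc n \<le> 3")
    case True
    obtain b where "cpos b" "b ^ 8 \<in> J" "F \<subseteq> principal_ideal (b ^ 3)"
      using J Suc.prems by (rule ideal_finite_subset_principal_ideal_3)
    then show ?thesis
      using principal_ideal_power_antimono [OF True, of b] by blast
  next
    case False
    \<comment> \<open>With \<open>k >= 2\<close> the exponent \<open>2 * k\<close> of the products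
      is at least \<open>Suc n = k + 2\<close>.\<close>
    then obtain k where k: "n = Suc k" "k \<ge> 2"
      by (cases n) auto
    have "\<forall>x\<in>F. \<exists>G. finite G \<and> G \<subseteq> J \<and> x \<in> group_closure {y * z | y z. y \<in> G \<and> z \<in> G}"
    proof
      fix x assume "x \<in> F"
      then show "\<exists>G. finite G \<and> G \<subseteq> J \<and> x \<in> group_closure {y * z | y z. y \<in> G \<and> z \<in> G}"
        by (intro group_closure_products_finite subsetD [OF idem] subsetD [OF Suc.prems(2)])
    qed
    from bchoice [OF this] obtain G where choice: "\<forall>x\<in>F. finite (G x) \<and> G x \<subseteq> J
        \<and> x \<in> group_closure {y * z | y z. y \<in> G x \<and> z \<in> G x}" ..
    have G: "finite (G x)" "G x \<subseteq> J" "x \<in> group_closure {y * z | y z. y \<in> G x \<and> z \<in> G x}"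
      if "x \<in> F" for x
      using bspec [OF choice that] by (rule conjE, simp)+
    have "finite (\<Union>(G ` F))"
      using Suc.prems(1) G(1) by (rule finite_UN_I)
    moreover have "\<Union>(G ` F) \<subseteq> J"
      using G(2) by (rule UN_least)
    ultimately have GF: "finite (\<Union>(G ` F))" "\<Union>(G ` F) \<subseteq> J" .
    from Suc.IH [OF GF]
    obtain b where b: "cpos b" "b ^ 8 \<in> J" "\<Union>(G ` F) \<subseteq> principal_ideal (b ^ n)"
      by blast
    have "x \<in> principal_ideal (b ^ Suc n)" if "x \<in> F" for x
    proof -
      have "{y * z | y z. y \<in> G x \<and> z \<in> G x} \<subseteq> principal_ideal (b ^ (2 * k))"
      proof clarify
        fix y z assume "y \<in> G x" "z \<in> G x"
        then have "y \<in> principal_ideal (b ^ Suc k)" "z \<in> principal_ideal (b ^ Suc k)"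
          using b(3) that unfolding k(1) by blast+
        then show "y * z \<in> principal_ideal (b ^ (2 * k))"
          by (rule principal_ideal_power_mult [OF b(1)])
      qed
      then have "x \<in> principal_ideal (b ^ (2 * k))"
        using group_closure_subset_ideal [OF two_sided_ideal_principal_ideal] G(3) [OF that] by blast
      moreover have "Suc n \<le> 2 * k"
        using k by simp
      ultimately show ?thesis
        using principal_ideal_power_antimono [of "Suc n" "2 * k" b] by blast
    qed
    then show ?thesis
      using b by blast
  qed
qed

text \<open>The even exponent makes every summand equal to
  \<open>star (b ^ k * r) * (b ^ k * r)\<close> for self-adjoint \<open>b\<close>; lists allow
  repetitions.\<close>

definition power_cone :: "'a::cstar_algebra_1 \<Rightarrow> nat \<Rightarrow> 'a set" where
  "power_cone b k = {(\<Sum>r\<leftarrow>rs. star r * b ^ (2 * k) * r) | rs. True}"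

lemma cpos_power_cone:
  assumes "cpos b" "g \<in> power_cone b k"
  shows "cpos g"
proof -
  obtain rs where "g = (\<Sum>r\<leftarrow>rs. star r * b ^ (2 * k) * r)"
    using assms(2) by (auto simp: power_cone_def)
  moreover have "cpos (\<Sum>r\<leftarrow>rs. star r * b ^ (2 * k) * r)"
    by (induction rs) (auto intro: cpos_add cpos_conj cpos_power assms(1))
  ultimately show ?thesis by simp
qed

lemma power_cone_add:
  assumes "g \<in> power_cone b k" "h \<in> power_cone b k"
  shows "g + h \<in> power_cone b k"
proof -
  obtain rs ts where "g = (\<Sum>r\<leftarrow>rs. star r * b ^ (2 * k) * r)"
      "h = (\<Sum>r\<leftarrow>ts. star r * b ^ (2 * k) * r)"
    using assms by (auto simp: power_cone_def)
  then have "g + h = (\<Sum>r\<leftarrow>rs @ ts. star r * b ^ (2 * k) * r)"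
    by simp
  then show ?thesis
    unfolding power_cone_def by blast
qed

lemma power_cone_subset_ideal:
  assumes J: "two_sided_ideal J" and b: "b ^ (2 * k) \<in> J" and g: "g \<in> power_cone b k"
  shows "g \<in> J"
proof -
  obtain rs where "g = (\<Sum>r\<leftarrow>rs. star r * b ^ (2 * k) * r)"
    using g by (auto simp: power_cone_def)
  moreover have "(\<Sum>r\<leftarrow>rs. star r * b ^ (2 * k) * r) \<in> J"
    by (induction rs) (use J b in \<open>auto simp: two_sided_ideal_def\<close>)
  ultimately show ?thesis by simp
qed

text \<open>For \<open>a = p * c * q\<close>, expand the positive element
  \<open>star (star p - q) * c * (star p - q)\<close> and its analogue with plus signs. Both signs
  are carried because the induction passes to differences.\<close>

lemma principal_ideal_dominated_by_cone:
  assumes b: "cpos b" and "a \<in> principal_ideal (b ^ (2 * k))"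
  shows "\<exists>g\<in>power_cone b k. cpos (g - (a + star a)) \<and> cpos (g + (a + star a))"
  using assms(2) unfolding principal_ideal_def
proof induction
  case (base a)
  then consider "a = 0" | p q where "a = p * b ^ (2 * k) * q"
    by blast
  then show ?case
  proof cases
    case 1
    have "0 \<in> power_cone b k"
      unfolding power_cone_def by (auto intro!: exI [of _ "[]"])
    then show ?thesis
      using 1 by (intro bexI [of _ 0]) simp_all
  next
    case 2
    define c where "c = b ^ (2 * k)"
    have c: "cpos c"
      unfolding c_def by (intro cpos_power b)
    have g: "p * c * star p + star q * c * q \<in> power_cone b k"
      unfolding power_cone_def c_def by (auto simp: star_star intro!: exI [of _ "[star p, q]"])
    have "a + star a = p * c * q + star q * c * star p"
      by (simp add: 2 star_mult mult.assoc cpos_star [OF c] flip: c_def)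
    then have "p * c * star p + star q * c * q - (a + star a)
          = star (star p - q) * c * (star p - q)"
      "p * c * star p + star q * c * q + (a + star a)
          = star (star p + q) * c * (star p + q)"
      by (simp_all add: star_diff star_add star_star algebra_simps)
    then show ?thesis
      using g cpos_conj [OF c] by (intro bexI [OF _ g]) simp
  qed
next
  case (diff s t)
  then obtain g h where gh: "g \<in> power_cone b k" "cpos (g - (s + star s))" "cpos (g + (s + star s))"
    "h \<in> power_cone b k" "cpos (h - (t + star t))" "cpos (h + (t + star t))"
    by blast
  have "cpos (g + h - (s - t + star (s - t)))"
    using cpos_add [OF gh(2,6)] by (simp add: star_diff algebra_simps)
  moreover have "cpos (g + h + (s - t + star (s - t)))"
    using cpos_add [OF gh(3,5)] by (simp add: star_diff algebra_simps)
  ultimately show ?case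
    using power_cone_add [OF gh(1,4)] by blast
qed

lemma cpos_sum_list_diff:
  assumes "r \<in> set rs" "\<And>r. r \<in> set rs \<Longrightarrow> cpos (f r)"
  shows "cpos ((\<Sum>r\<leftarrow>rs. f r) - f r)"
proof -
  have nonneg: "cpos (\<Sum>r\<leftarrow>ts. f r)" if "set ts \<subseteq> set rs" for ts
    using that by (induction ts) (auto intro: cpos_add assms(2))
  obtain us vs where rs: "rs = us @ r # vs"
    using split_list [OF assms(1)] by blast
  have "cpos ((\<Sum>r\<leftarrow>us. f r) + (\<Sum>r\<leftarrow>vs. f r))"
    by (intro cpos_add nonneg) (auto simp: rs)
  then show ?thesis
    by (simp add: rs)
qed

lemma tendsto_sum_list:
  fixes f :: "'b \<Rightarrow> nat \<Rightarrow> 'a::real_normed_vector"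
  assumes "\<And>r. r \<in> set rs \<Longrightarrow> f r \<longlonglongrightarrow> l r"
  shows "(\<lambda>n. \<Sum>r\<leftarrow>rs. f r n) \<longlonglongrightarrow> (\<Sum>r\<leftarrow>rs. l r)"
  using assms by (induction rs) (auto intro: tendsto_add)

text \<open>
  Write \<open>\<theta> = \<gamma>\<^sup>2\<close> and \<open>\<theta>\<^sup>2 = \<Sum> z\<^sup>* z\<close> with \<open>z = b\<^sup>k r\<close>. The factorizations \<open>z = w \<gamma>\<close> satisfy
  \<open>\<Sum> w\<^sup>* w = \<theta>\<close>, and \<open>(w w\<^sup>*)\<^sup>2 \<le> w \<theta> w\<^sup>* = z z\<^sup>*\<close> is dominated by a multiple of \<open>b\<^sup>2\<^sup>k\<close>; hence
  \<open>w w\<^sup>*\<close> is dominated by a multiple of \<open>b\<^sup>k\<close>, and \<open>w\<close> is left divisible by a power of \<open>b\<close>.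
\<close>

lemma power_cone_sqrt:
  assumes b: "cpos b" and \<theta>: "cpos \<theta>" and g: "\<theta> * \<theta> \<in> power_cone b (2 * i + 2)"
  shows "\<theta> \<in> power_cone b i"
proof -
  obtain \<gamma> where \<gamma>: "cpos \<gamma>" "\<gamma> * \<gamma> = \<theta>"
    using \<theta> by (rule cpos_sqrt)
  have \<gamma>2: "\<gamma> ^ 2 = \<theta>"
    by (simp add: power2_eq_square \<gamma>(2))
  have \<gamma>4: "\<gamma> ^ 4 = \<theta> * \<theta>"
    by (simp add: numeral_eq_Suc mult.assoc flip: \<gamma>(2))
  define k where "k = 2 * i + 2"
  obtain rs where rs: "\<theta> * \<theta> = (\<Sum>r\<leftarrow>rs. star r * b ^ (2 * k) * r)"
    using g by (auto simp: power_cone_def k_def)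
  define z where "z r = b ^ k * r" for r
  have sbk: "star (b ^ k) = b ^ k"
    by (intro cpos_star cpos_power b)
  have zz: "star (z r) * z r = star r * b ^ (2 * k) * r" for r
    by (simp add: z_def star_mult sbk mult.assoc mult_2 power_add)
  have "\<exists>w. (\<lambda>n. z r * approx_inv \<gamma> n) \<longlonglongrightarrow> w \<and> w * \<gamma> = z r" if "r \<in> set rs" for r
  proof -
    have "cpos ((\<Sum>r\<leftarrow>rs. star (z r) * z r) - star (z r) * z r)"
      by (rule cpos_sum_list_diff [OF that]) (rule cpos_star_mult)
    then have "cpos (1 *\<^sub>R \<gamma> ^ 4 - star (z r) * z r)"
      by (simp add: \<gamma>4 rs zz)
    then show ?thesis
      using approx_inv_factor_4 [OF \<gamma>(1), of 1 "z r"] by (metis zero_le_one)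
  qed
  then obtain w where w: "\<And>r. r \<in> set rs \<Longrightarrow> (\<lambda>n. z r * approx_inv \<gamma> n) \<longlonglongrightarrow> w r"
      "\<And>r. r \<in> set rs \<Longrightarrow> w r * \<gamma> = z r"
    by metis
  have "(\<lambda>n. \<Sum>r\<leftarrow>rs. star (z r * approx_inv \<gamma> n) * (z r * approx_inv \<gamma> n))
      \<longlonglongrightarrow> (\<Sum>r\<leftarrow>rs. star (w r) * w r)"
    by (intro tendsto_sum_list tendsto_mult tendsto_star w)
  \<comment> \<open>By linearity the sum is the compression of \<open>\<gamma> ^ 4\<close>, whose
    limit is \<open>\<gamma> ^ 2 = \<theta>\<close>.\<close>
  moreover have "(\<Sum>r\<leftarrow>rs. star (z r * approx_inv \<gamma> n) * (z r * approx_inv \<gamma> n))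
      = approx_inv \<gamma> n * \<gamma> ^ (0 + 4) * approx_inv \<gamma> n" for n
  proof -
    have "star (z r * approx_inv \<gamma> n) * (z r * approx_inv \<gamma> n)
        = approx_inv \<gamma> n * (star (z r) * z r) * approx_inv \<gamma> n" for r
      by (simp add: star_mult cpos_star cpos_approx_inv \<gamma>(1) mult.assoc)
    then show ?thesis
      by (simp only: add_0 \<gamma>4 rs zz sum_list_const_mult sum_list_mult_const)
  qed
  ultimately have "(\<Sum>r\<leftarrow>rs. star (w r) * w r) = \<gamma> ^ (0 + 2)"
    using power_approx_inv_tendsto [OF \<gamma>(1), of 0] LIMSEQ_unique by simp
  then have sum_w: "\<theta> = (\<Sum>r\<leftarrow>rs. star (w r) * w r)"
    by (simp only: add_0 \<gamma>2)
  have "\<exists>v. star (w r) * w r = star v * b ^ (2 * i) * v" if r: "r \<in> set rs" for r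
  proof -
    define e where "e = w r * star (w r)"
    define N where "N = norm (r * star r)"
    define f where "f = sqrt N *\<^sub>R b ^ k"
    have N: "N \<ge> 0"
      by (simp add: N_def)
    have "cpos (\<theta> - star (w r) * w r)"
      unfolding sum_w using r cpos_star_mult by (rule cpos_sum_list_diff)
    then have "cpos (w r * (\<theta> - star (w r) * w r) * star (w r))"
      using cpos_conj [of _ "star (w r)"] by (simp add: star_star)
    moreover have "w r * (\<theta> - star (w r) * w r) * star (w r)
        = (w r * \<gamma>) * star (w r * \<gamma>) - e * e"
      unfolding \<gamma>(2) [symmetric]
      by (simp add: right_diff_distrib left_diff_distrib e_def star_mult cpos_star \<gamma>(1) mult.assoc)
    ultimately have 1: "cpos (z r * star (z r) - e * e)"
      by (simp add: w(2) [OF r])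
    have "cpos (N *\<^sub>R 1 - r * star r)"
      unfolding N_def by (intro cpos_norm_minus cpos_star cpos_mult_star) simp
    then have "cpos (b ^ k * (N *\<^sub>R 1 - r * star r) * b ^ k)"
      using cpos_conj [of _ "b ^ k"] unfolding sbk by blast
    moreover have "b ^ k * (N *\<^sub>R 1 - r * star r) * b ^ k = f * f - z r * star (z r)"
      unfolding f_def z_def star_mult sbk right_diff_distrib left_diff_distrib
      using N by (simp add: mult.assoc)
    ultimately have "cpos (f * f - z r * star (z r))"
      by (simp only:)
    with 1 have "cpos (f * f - e * e)"
      by (rule cpos_diff_trans)
    moreover have "cpos e" "cpos f"
      using N by (simp_all add: e_def f_def cpos_mult_star cpos_scaleR cpos_power b)
    ultimately have "cpos (f - e)"
      using cpos_diff_if_squares by blast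
    \<comment> \<open>Here \<open>f\<close> carries the exponent \<open>k = 2 * i + 2\<close>, so
      this is the hypothesis of \<open>cpos_factor\<close> for \<open>star (w r)\<close> with
      exponent \<open>i\<close>.\<close>
    then have "cpos (sqrt N *\<^sub>R b ^ (2 * i + 2) - star (star (w r)) * star (w r))"
      by (simp add: f_def e_def k_def star_star)
    from cpos_factor [OF b real_sqrt_ge_zero [OF N] this]
    obtain u where u: "star (w r) = u * b ^ i" ..
    have "w r = b ^ i * star u"
      using arg_cong [OF u, of star] by (simp add: star_mult star_star cpos_star cpos_power b)
    with u have "star (w r) * w r = star (star u) * b ^ (2 * i) * star u"
      by (simp add: star_star mult.assoc mult_2 power_add)
    then show ?thesis ..
  qed
  then obtain v where "\<And>r. r \<in> set rs \<Longrightarrow> star (w r) * w r = star (v r) * b ^ (2 * i) * v r"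
    by metis
  then have "\<theta> = (\<Sum>r\<leftarrow>map v rs. star r * b ^ (2 * i) * r)"
    unfolding sum_w by (simp add: comp_def cong: map_cong)
  then show ?thesis
    unfolding power_cone_def by blast
qed

text \<open>The exponents: \<open>22 = 2 \<sqdot> 10 + 2\<close> and \<open>10 = 2 \<sqdot> 4 + 2\<close>, so two square roots lead to \<open>b\<^sup>8\<close>.\<close>

lemma idempotent_ideal_sqrt:
  fixes J :: "'a::cstar_algebra_1 set"
  assumes J: "two_sided_ideal J" and idem: "J \<subseteq> group_closure {y * z | y z. y \<in> J \<and> z \<in> J}"
    and s: "cpos s" and ss: "s * s \<in> J"
  shows "s \<in> J"
proof -
  obtain b where b: "cpos b" "b ^ 8 \<in> J" "s * s \<in> principal_ideal (b ^ (2 * 22))"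
    using idempotent_ideal_finite_subset_principal_ideal [OF J idem, of "{s * s}" "2 * 22"] ss by auto
  have cs: "cpos (s * s)"
    by (intro cpos_square cpos_star s)
  obtain g where g: "g \<in> power_cone b 22" "cpos (g - (s * s + star (s * s)))"
    using principal_ideal_dominated_by_cone [OF b(1,3)] by blast
  \<comment> \<open>The cone element dominates two copies of \<open>s * s\<close>; one of them,
    being positive, is dropped.\<close>
  have gs: "cpos (g - s * s)"
    using cpos_add [OF g(2) cs] by (simp add: cpos_star [OF cs])
  obtain \<theta> where \<theta>: "cpos \<theta>" "\<theta> * \<theta> = g"
    using cpos_power_cone [OF b(1) g(1)] by (rule cpos_sqrt)
  obtain \<gamma> where \<gamma>: "cpos \<gamma>" "\<gamma> * \<gamma> = \<theta>"
    using \<theta>(1) by (rule cpos_sqrt)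
  have "\<theta> \<in> power_cone b 10"
    using power_cone_sqrt [OF b(1) \<theta>(1), of 10] \<theta>(2) g(1) by simp
  then have "\<gamma> \<in> power_cone b 4"
    using power_cone_sqrt [OF b(1) \<gamma>(1), of 4] \<gamma>(2) by simp
  moreover have "b ^ (2 * 4) \<in> J"
    using b(2) by simp
  ultimately have \<gamma>J: "\<gamma> \<in> J"
    using power_cone_subset_ideal [OF J] by blast
  have "\<gamma> ^ 4 = g"
    by (simp add: numeral_eq_Suc mult.assoc flip: \<gamma>(2) \<theta>(2))
  \<comment> \<open>The case of exponent 1 in \<open>cpos_factor\<close>:
    \<open>star s * s <= \<gamma> ^ 4\<close> makes \<open>s\<close> a left multiple of
    \<open>\<gamma>\<close>.\<close>
  then have "cpos (1 *\<^sub>R \<gamma> ^ (2 * 1 + 2) - star s * s)"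
    using gs by (simp add: cpos_star s)
  from cpos_factor [OF \<gamma>(1) zero_le_one this]
  obtain u where "s = u * \<gamma> ^ 1" ..
  then show ?thesis
    using \<gamma>J J by (simp add: two_sided_ideal_def)
qed

text \<open>With \<open>a = star x * x\<close>, pass from \<open>a ^ n\<close> to
  \<open>a ^ (2 ^ n)\<close> and take \<open>n\<close> square roots to reach \<open>a\<close>. Two
  more give a fourth root \<open>\<gamma>\<close> in \<open>J\<close>, and
  \<open>star x * x = \<gamma> ^ 4\<close> makes \<open>x\<close> a left multiple of it.\<close>

lemma idempotent_ideal_mem_if_power_mem:
  fixes J :: "'a::cstar_algebra_1 set"
  assumes J: "two_sided_ideal J" and idem: "J \<subseteq> group_closure {y * z | y z. y \<in> J \<and> z \<in> J}"
    and x: "(star x * x) ^ n \<in> J"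
  shows "x \<in> J"
proof -
  define a where "a = star x * x"
  have a: "cpos a"
    unfolding a_def by (rule cpos_star_mult)
  have root: "a \<in> J" if "a ^ (2 ^ m) \<in> J" for m
    using that
  proof (induction m)
    case (Suc m)
    have "a ^ 2 ^ m * a ^ 2 ^ m \<in> J"
      using Suc.prems by (simp add: mult_2 power_add)
    then have "a ^ 2 ^ m \<in> J"
      by (rule idempotent_ideal_sqrt [OF J idem cpos_power [OF a]])
    then show ?case
      by (rule Suc.IH)
  qed simp
  have "a ^ (2 ^ n) = a ^ n * a ^ (2 ^ n - n)"
    using less_exp [of n] by (simp flip: power_add)
  then have "a ^ (2 ^ n) \<in> J"
    using x J by (simp add: two_sided_ideal_def a_def)
  then have aJ: "a \<in> J"
    by (rule root)
  obtain \<theta> where \<theta>: "cpos \<theta>" "\<theta> * \<theta> = a"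
    using a by (rule cpos_sqrt)
  obtain \<gamma> where \<gamma>: "cpos \<gamma>" "\<gamma> * \<gamma> = \<theta>"
    using \<theta>(1) by (rule cpos_sqrt)
  have "\<theta> \<in> J"
    by (rule idempotent_ideal_sqrt [OF J idem \<theta>(1)]) (simp only: \<theta>(2) aJ)
  then have \<gamma>J: "\<gamma> \<in> J"
    by (intro idempotent_ideal_sqrt [OF J idem \<gamma>(1)]) (simp only: \<gamma>(2))
  have "\<gamma> ^ 4 = a"
    by (simp add: numeral_eq_Suc mult.assoc flip: \<gamma>(2) \<theta>(2))
  then have "cpos (1 *\<^sub>R \<gamma> ^ (2 * 1 + 2) - star x * x)"
    by (simp add: a_def)
  from cpos_factor [OF \<gamma>(1) zero_le_one this]
  obtain u where "x = u * \<gamma> ^ 1" ..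
  then show ?thesis
    using J \<gamma>J by (simp add: two_sided_ideal_def)
qed

subsection \<open>The unitization\<close>

datatype 'a unitization = Unitization (scalar_part: complex) (algebra_part: 'a)

text \<open>Left multiplication on the algebra by the formal sum of scalar part and algebra part;
  its operator norm enters the norm of the unitization.\<close>

definition unitization_op :: "'a::cstar_algebra unitization \<Rightarrow> 'a \<Rightarrow> 'a" where
  "unitization_op x b = scalar_part x *\<^sub>C b + algebra_part x * b"

lemma scaleC_zero_left [simp]: "0 *\<^sub>C x = (0::'a::cstar_algebra)"
  using scaleC_of_real [of 0 x] by simp

lemma scaleC_zero_right [simp]: "c *\<^sub>C 0 = (0::'a::cstar_algebra)"
  using scaleC_add_right [of c 0 "0::'a"] by simp

lemma scaleC_one [simp]: "1 *\<^sub>C x = (x::'a::cstar_algebra)"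
  using scaleC_of_real [of 1 x] by simp

lemma scaleR_complex_scaleC: "(r *\<^sub>R c) *\<^sub>C x = r *\<^sub>R (c *\<^sub>C (x::'a::cstar_algebra))"
  by (simp add: scaleR_conv_of_real scaleC_scaleC flip: scaleC_of_real)

lemma scaleC_scaleR: "c *\<^sub>C (r *\<^sub>R x) = r *\<^sub>R (c *\<^sub>C (x::'a::cstar_algebra))"
  by (simp add: scaleC_scaleC mult.commute flip: scaleC_of_real)

instantiation unitization :: (cstar_algebra) real_algebra_1
begin

definition "0 = Unitization 0 0"
definition "1 = Unitization 1 0"
definition "x + y = Unitization (scalar_part x + scalar_part y) (algebra_part x + algebra_part y)"
definition "- x = Unitization (- scalar_part x) (- algebra_part x)"
definition "x - y = Unitization (scalar_part x - scalar_part y) (algebra_part x - algebra_part y)"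
definition "x * y = Unitization (scalar_part x * scalar_part y)
  (scalar_part x *\<^sub>C algebra_part y + scalar_part y *\<^sub>C algebra_part x + algebra_part x * algebra_part y)"
definition "r *\<^sub>R x = Unitization (r *\<^sub>R scalar_part x) (r *\<^sub>R algebra_part x)"

lemmas unitization_simps =
  zero_unitization_def one_unitization_def plus_unitization_def uminus_unitization_def
  minus_unitization_def times_unitization_def scaleR_unitization_def

instance
  by standard
    (simp_all add: unitization_simps unitization.expand algebra_simps scaleC_scaleC scaleC_add_left
      scaleC_add_right mult_scaleC_left mult_scaleC_right scaleR_complex_scaleC scaleC_scaleR)

end

lemma unitization_op_scaleR: "unitization_op x (r *\<^sub>R b) = r *\<^sub>R unitization_op x b"
  by (simp add: unitization_op_def scaleC_scaleR scaleR_add_right)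

lemma bounded_linear_unitization_op: "bounded_linear (unitization_op x)"
proof (rule bounded_linear_intro)
  show "unitization_op x (a + b) = unitization_op x a + unitization_op x b" for a b
    by (simp add: unitization_op_def scaleC_add_right distrib_left algebra_simps)
  show "norm (unitization_op x b) \<le> norm b * (cmod (scalar_part x) + norm (algebra_part x))" for b
    using norm_triangle_ineq [of "scalar_part x *\<^sub>C b" "algebra_part x * b"]
      norm_mult_ineq [of "algebra_part x" b]
    by (simp add: unitization_op_def norm_scaleC algebra_simps)
qed (rule unitization_op_scaleR)

lemma unitization_op_add: "unitization_op (x + y) b = unitization_op x b + unitization_op y b"
  by (simp add: unitization_op_def unitization_simps scaleC_add_left algebra_simps)

lemma unitization_op_mult: "unitization_op (x * y) b = unitization_op x (unitization_op y b)"
  by (simp add: unitization_op_def unitization_simps scaleC_add_right scaleC_scaleC algebra_simps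
      mult_scaleC_left mult_scaleC_right)

text \<open>
  The operator norm of left multiplication vanishes at \<open>1 - e\<close> if \<open>e\<close> is already a unit of the
  algebra; the maximum with the modulus of the scalar part makes it definite.
\<close>

instantiation unitization :: (cstar_algebra) real_normed_algebra_1
begin

definition "norm x = max (cmod (scalar_part x)) (onorm (unitization_op x))"
definition "dist x y = norm (x - y :: 'a unitization)"
definition "uniformity = (INF e\<in>{0<..}. principal {(x :: 'a unitization, y). dist x y < e})"
definition "open U \<longleftrightarrow> (\<forall>x\<in>U. \<forall>\<^sub>F (x', y) in uniformity. x' = x \<longrightarrow> y \<in> (U :: 'a unitization set))"
definition "sgn x = x /\<^sub>R norm (x :: 'a unitization)"

lemma norm_scalar_part_le: "cmod (scalar_part x) \<le> norm (x :: 'a unitization)"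
  by (simp add: norm_unitization_def)

lemma norm_unitization_op_le: "norm (unitization_op x b) \<le> norm x * norm (b :: 'a)"
proof -
  have "norm (unitization_op x b) \<le> onorm (unitization_op x) * norm b"
    by (rule onorm [OF bounded_linear_unitization_op])
  also have "\<dots> \<le> norm x * norm b"
    by (intro mult_right_mono) (simp_all add: norm_unitization_def)
  finally show ?thesis .
qed

lemma norm_unitization_leI:
  assumes "cmod (scalar_part x) \<le> K" "\<And>b. norm (unitization_op x b) \<le> K * norm (b :: 'a)"
  shows "norm x \<le> K"
proof -
  have "K \<ge> 0"
    using assms(1) norm_ge_zero order_trans by blast
  then show ?thesis
    using assms by (simp add: norm_unitization_def onorm_bound)
qed

text \<open>Testing the operator on \<open>star a\<close> attains the upper bound, by the
  C*-identity.\<close>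

lemma norm_algebra_element: "norm (Unitization 0 a) = norm (a :: 'a)"
proof (rule antisym)
  show "norm (Unitization 0 a) \<le> norm a"
    by (rule norm_unitization_leI) (simp_all add: unitization_op_def norm_mult_ineq)
  have "(norm a)\<^sup>2 \<le> norm (Unitization 0 a) * norm a"
    using norm_unitization_op_le [of "Unitization 0 a" "star a"]
    by (simp add: unitization_op_def norm_mult_star)
  then show "norm a \<le> norm (Unitization 0 a)"
    using norm_scalar_part_le [of "Unitization 0 a"]
    by (cases "a = 0") (simp_all add: power2_eq_square)
qed

instance
proof
  fix x y :: "'a unitization" and r :: real
  show "norm (x + y) \<le> norm x + norm y"
  proof (rule norm_unitization_leI)
    show "cmod (scalar_part (x + y)) \<le> norm x + norm y"
      using norm_triangle_ineq [of "scalar_part x" "scalar_part y"]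
        norm_scalar_part_le [of x] norm_scalar_part_le [of y]
      by (simp add: unitization_simps)
    show "norm (unitization_op (x + y) b) \<le> (norm x + norm y) * norm b" for b
      using norm_triangle_ineq [of "unitization_op x b" "unitization_op y b"]
        norm_unitization_op_le [of x b] norm_unitization_op_le [of y b]
      by (simp add: unitization_op_add distrib_right)
  qed
  show "norm (x * y) \<le> norm x * norm y"
  proof (rule norm_unitization_leI)
    show "cmod (scalar_part (x * y)) \<le> norm x * norm y"
      by (auto simp: unitization_simps norm_mult norm_scalar_part_le
          intro!: mult_mono order_trans [OF norm_ge_zero norm_scalar_part_le])
    show "norm (unitization_op (x * y) b) \<le> norm x * norm y * norm b" for b
    proof -
      have "norm (unitization_op (x * y) b) \<le> norm x * norm (unitization_op y b)"
        unfolding unitization_op_mult by (rule norm_unitization_op_le)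
      also have "\<dots> \<le> norm x * (norm y * norm b)"
        by (intro mult_left_mono norm_unitization_op_le order_trans [OF norm_ge_zero norm_scalar_part_le])
      finally show ?thesis by (simp add: mult.assoc)
    qed
  qed
  show "norm (r *\<^sub>R x) = \<bar>r\<bar> * norm x"
  proof -
    have "unitization_op (r *\<^sub>R x) = (\<lambda>b. r *\<^sub>R unitization_op x b)"
      by (rule ext) (simp add: unitization_op_def unitization_simps scaleR_complex_scaleC scaleR_add_right)
    then have "onorm (unitization_op (r *\<^sub>R x)) = \<bar>r\<bar> * onorm (unitization_op x)"
      by (simp add: onorm_scaleR [OF bounded_linear_unitization_op])
    then show ?thesis
      by (simp add: norm_unitization_def unitization_simps max_mult_distrib_left)
  qed
  show "norm x = 0 \<longleftrightarrow> x = 0"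
  proof
    assume n: "norm x = 0"
    then have "scalar_part x = 0"
      using norm_scalar_part_le [of x] by simp
    then have "x = Unitization 0 (algebra_part x)"
      by (cases x) simp
    then show "x = 0"
      using n norm_algebra_element [of "algebra_part x"] by (simp add: zero_unitization_def)
  next
    assume "x = 0"
    then show "norm x = 0"
      using norm_algebra_element [of 0] by (simp add: zero_unitization_def)
  qed
  have "unitization_op (1 :: 'a unitization) = (\<lambda>b. b)"
    by (rule ext) (simp add: unitization_op_def unitization_simps)
  \<comment> \<open>The operator norm of the identity is at most 1, and 0 for the zero algebra; the
    scalar part attains 1.\<close>
  then show "norm (1 :: 'a unitization) = 1"
    using onorm_id_le [where ?'a = 'a] by (simp add: norm_unitization_def one_unitization_def max_def)
qed (rule dist_unitization_def sgn_unitization_def uniformity_unitization_def open_unitization_def)+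

end

text \<open>The norm is equivalent to the sum of the norms of the two parts, so Cauchy sequences
  converge componentwise.\<close>

instance unitization :: (cstar_algebra) banach
proof
  fix X :: "nat \<Rightarrow> 'a unitization"
  assume X: "Cauchy X"
  have norm_parts: "norm x \<le> cmod (scalar_part x) + norm (algebra_part x)" for x :: "'a unitization"
  proof (rule norm_unitization_leI)
    show "norm (unitization_op x b) \<le> (cmod (scalar_part x) + norm (algebra_part x)) * norm b" for b
      unfolding unitization_op_def distrib_right
      by (rule norm_triangle_mono) (simp_all add: norm_scaleC norm_mult_ineq)
  qed simp
  have norm_algebra_part: "norm (algebra_part x) \<le> 2 * norm x" for x :: "'a unitization"
  proof -
    have "Unitization 0 (algebra_part x) = x - Unitization (scalar_part x) 0"
      by (simp add: minus_unitization_def)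
    then have "norm (algebra_part x) \<le> norm x + norm (Unitization (scalar_part x) (0::'a))"
      by (metis norm_algebra_element norm_triangle_ineq4)
    also have "norm (Unitization (scalar_part x) (0::'a)) \<le> norm x"
      using norm_parts [of "Unitization (scalar_part x) (0::'a)"] norm_scalar_part_le [of x] by simp
    finally show ?thesis by simp
  qed
  have "Cauchy (\<lambda>n. scalar_part (X n))"
  proof (rule CauchyI)
    fix e :: real assume "e > 0"
    then obtain M where M: "\<forall>m\<ge>M. \<forall>n\<ge>M. norm (X m - X n) < e"
      using CauchyD [OF X] by blast
    have "cmod (scalar_part (X m) - scalar_part (X n)) < e" if "m \<ge> M" "n \<ge> M" for m n
      using le_less_trans [OF norm_scalar_part_le [of "X m - X n"]] M that
      by (simp add: minus_unitization_def)
    then show "\<exists>M. \<forall>m\<ge>M. \<forall>n\<ge>M. cmod (scalar_part (X m) - scalar_part (X n)) < e"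
      by blast
  qed
  then obtain c where c: "(\<lambda>n. scalar_part (X n)) \<longlonglongrightarrow> c"
    using Cauchy_convergent convergent_def by blast
  have "Cauchy (\<lambda>n. algebra_part (X n))"
  proof (rule CauchyI)
    fix e :: real assume "e > 0"
    then obtain M where M: "\<forall>m\<ge>M. \<forall>n\<ge>M. norm (X m - X n) < e / 2"
      using CauchyD [OF X, of "e / 2"] by auto
    have "norm (algebra_part (X m) - algebra_part (X n)) < e" if "m \<ge> M" "n \<ge> M" for m n
    proof -
      have "norm (X m - X n) < e / 2"
        using M that by blast
      then have "norm (algebra_part (X m - X n)) < e"
        using norm_algebra_part [of "X m - X n"] by linarith
      then show ?thesis
        by (simp add: minus_unitization_def)
    qed
    then show "\<exists>M. \<forall>m\<ge>M. \<forall>n\<ge>M. norm (algebra_part (X m) - algebra_part (X n)) < e"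
      by blast
  qed
  then obtain a where a: "(\<lambda>n. algebra_part (X n)) \<longlonglongrightarrow> a"
    using Cauchy_convergent convergent_def by blast
  have "X \<longlonglongrightarrow> Unitization c a"
  proof (rule LIM_zero_cancel, rule Lim_null_comparison)
    have "(\<lambda>n. cmod (scalar_part (X n) - c) + norm (algebra_part (X n) - a)) \<longlonglongrightarrow> 0 + 0"
      by (intro tendsto_add tendsto_norm_zero LIM_zero c a)
    then show "(\<lambda>n. cmod (scalar_part (X n) - c) + norm (algebra_part (X n) - a)) \<longlonglongrightarrow> 0"
      by simp
    show "\<forall>\<^sub>F n in sequentially. norm (X n - Unitization c a)
        \<le> cmod (scalar_part (X n) - c) + norm (algebra_part (X n) - a)"
    proof (intro always_eventually allI)
      fix n
      show "norm (X n - Unitization c a) \<le> cmod (scalar_part (X n) - c) + norm (algebra_part (X n) - a)"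
        using norm_parts [of "X n - Unitization c a"] by (simp add: minus_unitization_def)
    qed
  qed
  then show "convergent X"
    by (rule convergentI)
qed

text \<open>The identity \<open>adj\<close> bounds \<open>norm (unitization_op x b)\<close> by
  \<open>sqrt (norm (star x * x)) * norm b\<close>, whence
  \<open>norm x ^ 2 <= norm (star x * x)\<close>. The converse is submultiplicativity together with
  \<open>norm (star x) <= norm x\<close>.\<close>

instantiation unitization :: (cstar_algebra) cstar_algebra_1
begin

definition "c *\<^sub>C x = Unitization (c * scalar_part x) (c *\<^sub>C algebra_part x)"
definition "star x = Unitization (cnj (scalar_part x)) (star (algebra_part x))"

instance
proof
  fix c d :: complex and r :: real and x y :: "'a unitization"
  note simps = scaleC_unitization_def star_unitization_def unitization_simps
  show "c *\<^sub>C (x + y) = c *\<^sub>C x + c *\<^sub>C y" "(c + d) *\<^sub>C x = c *\<^sub>C x + d *\<^sub>C x"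
    by (simp_all add: simps algebra_simps scaleC_add_right scaleC_add_left)
  show "c *\<^sub>C (d *\<^sub>C x) = (c * d) *\<^sub>C x" "complex_of_real r *\<^sub>C x = r *\<^sub>R x"
    by (simp_all add: simps mult.assoc scaleC_scaleC scaleC_of_real scaleR_conv_of_real)
  show "(c *\<^sub>C x) * y = c *\<^sub>C (x * y)" "x * (c *\<^sub>C y) = c *\<^sub>C (x * y)"
    by (simp_all add: simps algebra_simps scaleC_add_right scaleC_scaleC mult_scaleC_left mult_scaleC_right)
  show "star (x + y) = star x + star y" "star (c *\<^sub>C x) = cnj c *\<^sub>C star x"
      "star (x * y) = star y * star x"
    by (simp_all add: simps algebra_simps star_add star_scaleC star_mult)
  show ss: "star (star x) = x" for x :: "'a unitization"
    by (simp add: simps star_star)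
  show "norm (c *\<^sub>C x) = cmod c * norm x"
  proof -
    have le: "norm (c *\<^sub>C x) \<le> cmod c * norm x" for c and x :: "'a unitization"
    proof (rule norm_unitization_leI)
      have "unitization_op (c *\<^sub>C x) b = c *\<^sub>C unitization_op x b" for b
        by (simp add: unitization_op_def simps scaleC_add_right scaleC_scaleC mult_scaleC_left)
      then show "norm (unitization_op (c *\<^sub>C x) b) \<le> cmod c * norm x * norm b" for b
        using norm_unitization_op_le [of x b] by (simp add: norm_scaleC mult.assoc mult_left_mono)
    qed (simp add: simps norm_mult norm_scalar_part_le mult_left_mono)
    show ?thesis
    proof (cases "c = 0")
      case True
      then show ?thesis
        using le [of c x] by simp
    next
      case False
      have "x = inverse c *\<^sub>C (c *\<^sub>C x)"
        using False by (cases x) (simp add: simps scaleC_scaleC flip: mult.assoc)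
      then have "norm x \<le> cmod (inverse c) * norm (c *\<^sub>C x)"
        using le by metis
      then have "norm x \<le> norm (c *\<^sub>C x) / cmod c"
        by (simp add: norm_inverse divide_inverse mult.commute)
      then have "cmod c * norm x \<le> norm (c *\<^sub>C x)"
        using False by (simp add: pos_le_divide_eq mult.commute)
      then show ?thesis
        using le [of c x] by (rule antisym [rotated])
    qed
  qed
  have adj: "star (unitization_op x b) * unitization_op x b = star b * unitization_op (star x * x) b"
    for b and x :: "'a unitization"
    by (simp add: unitization_op_def simps star_add star_scaleC star_mult algebra_simps
        scaleC_scaleC scaleC_add_right mult_scaleC_left mult_scaleC_right)
  have sq: "(norm x)\<^sup>2 \<le> norm (star x * x)" for x :: "'a unitization"
  proof -
    have "norm (unitization_op x b) \<le> sqrt (norm (star x * x)) * norm b" for b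
    proof -
      have "(norm (unitization_op x b))\<^sup>2 = norm (star b * unitization_op (star x * x) b)"
        using norm_star_mult [of "unitization_op x b"] adj by simp
      also have "\<dots> \<le> norm b * norm (unitization_op (star x * x) b)"
        using norm_mult_ineq [of "star b"] by simp
      also have "\<dots> \<le> norm b * (norm (star x * x) * norm b)"
        by (intro mult_left_mono norm_unitization_op_le) simp
      also have "\<dots> = (sqrt (norm (star x * x)) * norm b)\<^sup>2"
        by (simp add: power2_eq_square)
      finally show ?thesis
        by (rule power2_le_imp_le) simp
    qed
    moreover have "cmod (scalar_part x) \<le> sqrt (norm (star x * x))"
      using norm_scalar_part_le [of "star x * x"]
      by (intro real_le_rsqrt) (simp add: simps norm_mult power2_eq_square)
    ultimately have "norm x \<le> sqrt (norm (star x * x))"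
      by (intro norm_unitization_leI)
    then have "(norm x)\<^sup>2 \<le> (sqrt (norm (star x * x)))\<^sup>2"
      by (rule power_mono) simp
    then show ?thesis by simp
  qed
  \<comment> \<open>The argument of \<open>norm_star\<close> is repeated, as that lemma presupposes
    the class instance.\<close>
  have le: "norm x \<le> norm (star x)" for x :: "'a unitization"
  proof (cases "x = 0")
    case False
    have "norm x * norm x \<le> norm (star x) * norm x"
      using sq [of x] norm_mult_ineq [of "star x" x] by (simp add: power2_eq_square)
    with False show ?thesis by simp
  qed simp
  have "norm (star x * x) \<le> norm x * norm x"
    using norm_mult_ineq [of "star x" x] le [of "star x"] mult_right_mono [of "norm (star x)" "norm x" "norm x"]
    by (simp add: ss)
  then show "norm (star x * x) = (norm x)\<^sup>2"
    using sq [of x] by (simp add: power2_eq_square)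
qed

end

subsection \<open>Powers of ideals\<close>

abbreviation embed :: "'a::cstar_algebra \<Rightarrow> 'a unitization" where
  "embed \<equiv> Unitization 0"

lemma embed_mult: "embed (x * y) = embed x * embed y"
  by (simp add: unitization_simps)

lemma embed_diff: "embed (x - y) = embed x - embed y"
  by (simp add: unitization_simps)

lemma embed_star: "embed (star x) = star (embed x)"
  by (simp add: star_unitization_def)

text \<open>
  An ideal \<open>J = J\<^sup>2\<close> absorbs complex scalars, because \<open>c (y z) = (c y) z\<close>; this makes it an ideal of
  the unitization.
\<close>

lemma two_sided_ideal_embed:
  fixes J :: "'a::cstar_algebra set"
  assumes J: "two_sided_ideal J" and idem: "J \<subseteq> group_closure {y * z | y z. y \<in> J \<and> z \<in> J}"
  shows "two_sided_ideal (embed ` J)"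
proof -
  have scale: "c *\<^sub>C x \<in> J" if "x \<in> J" for c x
    using subsetD [OF idem that]
  proof induction
    case (base s)
    then consider "s = 0" | y z where "s = y * z" "z \<in> J"
      by blast
    then show ?case
    proof cases
      case 2
      then have "c *\<^sub>C s = (c *\<^sub>C y) * z"
        by (simp add: mult_scaleC_left)
      then show ?thesis
        using J 2(2) by (simp add: two_sided_ideal_def)
    qed (use J in \<open>simp add: two_sided_ideal_def\<close>)
  next
    case (diff s t)
    then show ?case
      by (simp add: scaleC_diff_right two_sided_ideal_diff [OF J])
  qed
  show ?thesis
    unfolding two_sided_ideal_def
  proof (intro conjI ballI allI)
    show "0 \<in> embed ` J"
      using J by (auto simp: two_sided_ideal_def zero_unitization_def)
  next
    fix x y assume "x \<in> embed ` J" "y \<in> embed ` J"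
    then show "x + y \<in> embed ` J"
      using J by (auto simp: two_sided_ideal_def plus_unitization_def)
  next
    fix x assume "x \<in> embed ` J"
    then show "- x \<in> embed ` J"
      using J by (auto simp: two_sided_ideal_def uminus_unitization_def)
  next
    fix u x assume "x \<in> embed ` J"
    then obtain y where y: "x = embed y" "y \<in> J"
      by blast
    have "scalar_part u *\<^sub>C y + algebra_part u * y \<in> J" "scalar_part u *\<^sub>C y + y * algebra_part u \<in> J"
      using J y(2) scale unfolding two_sided_ideal_def by simp_all
    then show "u * x \<in> embed ` J" "x * u \<in> embed ` J"
      unfolding y(1) by (simp_all add: times_unitization_def)
  qed
qed

lemma embed_group_closure:
  assumes "x \<in> group_closure {y * z | y z. y \<in> J \<and> z \<in> J}"
  shows "embed x \<in> group_closure {y * z | y z. y \<in> embed ` J \<and> z \<in> embed ` J}"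
  using assms
proof induction
  case (base s)
  then consider "s = 0" | y z where "s = y * z" "y \<in> J" "z \<in> J"
    by blast
  then show ?case
  proof cases
    case 1
    then show ?thesis
      by (simp flip: zero_unitization_def)
  next
    case 2
    then show ?thesis
      unfolding 2(1) embed_mult by (intro group_closure.base) blast
  qed
next
  case (diff s t)
  then show ?case
    unfolding embed_diff by (intro group_closure.diff)
qed

section \<open>Arithmetic of the powers of an ideal\<close>

lemma foldl_mult_assoc: "foldl (*) (a * x) xs = a * foldl (*) (x::'a::semigroup_mult) xs"
  by (induction xs arbitrary: x) (simp_all add: mult.assoc)

lemma foldl_mult_in_ideal_power:
  "x \<in> I \<Longrightarrow> set xs \<subseteq> I \<Longrightarrow> foldl (*) x xs \<in> ideal_power I (Suc (length xs))"
  unfolding ideal_power_def by (rule group_closure.base) blast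

lemma ideal_power_induct [consumes 1, case_names zero product diff]:
  assumes "p \<in> ideal_power I (Suc n)"
    and "P 0"
    and "\<And>x xs. x \<in> I \<Longrightarrow> set xs \<subseteq> I \<Longrightarrow> length xs = n \<Longrightarrow> P (foldl (*) x xs)"
    and "\<And>p q. p \<in> ideal_power I (Suc n) \<Longrightarrow> q \<in> ideal_power I (Suc n) \<Longrightarrow> P p \<Longrightarrow> P q \<Longrightarrow> P (p - q)"
  shows "P p"
  using assms(1) unfolding ideal_power_def
proof induction
  case (base s)
  then show ?case
    using assms(2,3) by auto
next
  case (diff s t)
  then show ?case
    using assms(4) unfolding ideal_power_def by blast
qed

lemma ideal_power_diff:
  "p \<in> ideal_power I n \<Longrightarrow> q \<in> ideal_power I n \<Longrightarrow> p - q \<in> ideal_power I n"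
  unfolding ideal_power_def by (rule group_closure.diff)

lemma zero_in_ideal_power [simp]: "0 \<in> ideal_power I n"
  by (simp add: ideal_power_def)

lemma ideal_power_mult_right:
  assumes "p \<in> ideal_power I (Suc n)" "y \<in> I"
  shows "p * y \<in> ideal_power I (Suc (Suc n))"
  using assms(1)
proof (induction rule: ideal_power_induct)
  case (product x xs)
  then show ?case
    using foldl_mult_in_ideal_power [of x I "xs @ [y]"] assms(2) by simp
qed (simp_all add: left_diff_distrib ideal_power_diff)

text \<open>The first two factors merge into one element of \<open>I\<close>.\<close>

lemma ideal_power_Suc_subset:
  assumes I: "two_sided_ideal I"
  shows "ideal_power I (Suc (Suc n)) \<subseteq> ideal_power I (Suc n)"
proof
  fix p assume "p \<in> ideal_power I (Suc (Suc n))"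
  then show "p \<in> ideal_power I (Suc n)"
  proof (induction rule: ideal_power_induct)
    case (product x xs)
    then obtain y ys where "xs = y # ys" "length ys = n"
      by (cases xs) auto
    then show ?case
      using foldl_mult_in_ideal_power [of "x * y" I ys] product I by (simp add: two_sided_ideal_def)
  qed (simp_all add: ideal_power_diff)
qed

lemma ideal_power_antimono:
  assumes I: "two_sided_ideal I"
  shows "ideal_power I (Suc (m + n)) \<subseteq> ideal_power I (Suc m)"
  by (induction n) (use ideal_power_Suc_subset [OF I] in auto)

text \<open>A multiplier on the left is absorbed by the first factor, one on the right by the
  last.\<close>

lemma two_sided_ideal_ideal_power:
  assumes I: "two_sided_ideal I"
  shows "two_sided_ideal (ideal_power I (Suc n))"
  unfolding two_sided_ideal_def
proof (intro conjI ballI allI)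
  fix p q assume p: "p \<in> ideal_power I (Suc n)" and "q \<in> ideal_power I (Suc n)"
  then show "p + q \<in> ideal_power I (Suc n)"
    unfolding ideal_power_def by (rule group_closure_add)
next
  fix p assume p: "p \<in> ideal_power I (Suc n)"
  then show "- p \<in> ideal_power I (Suc n)"
    unfolding ideal_power_def by simp
  fix a
  from p show "a * p \<in> ideal_power I (Suc n)"
  proof (induction rule: ideal_power_induct)
    case (product x xs)
    then show ?case
      using foldl_mult_in_ideal_power [of "a * x" I xs] I
      by (simp add: foldl_mult_assoc two_sided_ideal_def)
  qed (simp_all add: right_diff_distrib ideal_power_diff)
  from p show "p * a \<in> ideal_power I (Suc n)"
  proof (induction rule: ideal_power_induct)
    case (product x xs)
    \<comment> \<open>With an empty list the first factor is also the last.\<close>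
    show ?case
    proof (cases xs rule: rev_cases)
      case Nil
      then show ?thesis
        using foldl_mult_in_ideal_power [of "x * a" I "[]"] product I by (simp add: two_sided_ideal_def)
    next
      case (snoc ys y)
      then show ?thesis
        using foldl_mult_in_ideal_power [of x I "ys @ [y * a]"] product I
        by (simp add: two_sided_ideal_def mult.assoc)
    qed
  qed (simp_all add: left_diff_distrib ideal_power_diff)
qed simp

text \<open>Split off the last factor, move the remaining product up by the induction hypothesis and
  multiply the factor back on.\<close>

lemma ideal_power_stable:
  assumes "ideal_power I (Suc n) \<subseteq> ideal_power I (Suc (Suc n))"
  shows "ideal_power I (Suc n) \<subseteq> ideal_power I (Suc (n + k))"
proof (induction k)
  case (Suc k)
  show ?case
  proof
    fix p assume "p \<in> ideal_power I (Suc n)"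
    then have "p \<in> ideal_power I (Suc (Suc n))"
      using assms by blast
    then show "p \<in> ideal_power I (Suc (n + Suc k))"
    proof (induction rule: ideal_power_induct)
      case (product x xs)
      then obtain ys y where xs: "xs = ys @ [y]" "length ys = n"
        by (cases xs rule: rev_cases) auto
      then have "foldl (*) x ys \<in> ideal_power I (Suc n)"
        using foldl_mult_in_ideal_power [of x I ys] product by simp
      then have "foldl (*) x ys \<in> ideal_power I (Suc (n + k))"
        using Suc.IH by blast
      then show ?case
        using ideal_power_mult_right [of _ I "n + k" y] product(2) xs by simp
    qed (simp_all add: ideal_power_diff)
  qed
qed simp

text \<open>A product of \<open>2 * (n + 1)\<close> factors is cut in the middle into two blocks of
  \<open>n + 1\<close>.\<close>

lemma ideal_power_double_subset:
  "ideal_power I (Suc (n + Suc n))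
     \<subseteq> group_closure {y * z | y z. y \<in> ideal_power I (Suc n) \<and> z \<in> ideal_power I (Suc n)}"
proof
  fix p assume "p \<in> ideal_power I (Suc (n + Suc n))"
  then show "p \<in> group_closure {y * z | y z. y \<in> ideal_power I (Suc n) \<and> z \<in> ideal_power I (Suc n)}"
  proof (induction rule: ideal_power_induct)
    case (product x xs)
    define us where "us = take n xs"
    obtain v vs where vs: "drop n xs = v # vs" "length vs = n"
      using product(3) by (cases "drop n xs") (auto dest: arg_cong [where f = length])
    have xs: "xs = us @ v # vs" "length us = n"
      using append_take_drop_id [of n xs] product(3) by (simp_all add: us_def vs)
    have "foldl (*) x us \<in> ideal_power I (Suc n)" "foldl (*) v vs \<in> ideal_power I (Suc n)"
      using foldl_mult_in_ideal_power [of x I us] foldl_mult_in_ideal_power [of v I vs] product xs vs(2)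
      by simp_all
    moreover have "foldl (*) x xs = foldl (*) x us * foldl (*) v vs"
      by (simp add: xs foldl_mult_assoc)
    ultimately show ?case
      by (intro group_closure.base) blast
  qed (auto intro: group_closure.diff)
qed

text \<open>The power relies on the unit of the unitization; inside the algebra its counterpart is a
  product with a first factor.\<close>

lemma embed_power: "embed a ^ Suc m = embed (foldl (*) a (replicate m a))"
proof (induction m)
  case (Suc m)
  have "embed a ^ Suc (Suc m) = embed (foldl (*) a (replicate m a @ [a]))"
    unfolding power_Suc2 [of _ "Suc m"] Suc by (simp add: embed_mult)
  then show ?case
    by (simp only: replicate_append_same replicate_Suc)
qed simp

text \<open>The stable power \<open>J\<close> is idempotent and contains a power of
  \<open>star x * x\<close>. Applied to the image of \<open>J\<close> in the unitization,
  \<open>idempotent_ideal_mem_if_power_mem\<close> puts \<open>x\<close> into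
  \<open>J\<close>.\<close>

lemma ideal_subset_stable_power:
  fixes I :: "'a::cstar_algebra set"
  assumes I: "two_sided_ideal I" and stable: "ideal_power I (Suc n) \<subseteq> ideal_power I (Suc (Suc n))"
  shows "I \<subseteq> ideal_power I (Suc n)"
proof
  fix x assume x: "x \<in> I"
  define J where "J = ideal_power I (Suc n)"
  have J: "two_sided_ideal J"
    unfolding J_def by (rule two_sided_ideal_ideal_power [OF I])
  have idem: "J \<subseteq> group_closure {y * z | y z. y \<in> J \<and> z \<in> J}"
    unfolding J_def using ideal_power_stable [OF stable, of "Suc n"] ideal_power_double_subset
    by (rule order_trans)
  have "star x * x \<in> I"
    using x I by (simp add: two_sided_ideal_def)
  then have "foldl (*) (star x * x) (replicate n (star x * x)) \<in> J"
    using foldl_mult_in_ideal_power [of "star x * x" I "replicate n (star x * x)"]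
    by (auto simp: J_def set_replicate_conv_if)
  then have power: "(star (embed x) * embed x) ^ Suc n \<in> embed ` J"
    unfolding embed_star [symmetric] embed_mult [symmetric] embed_power by (rule imageI)
  have "embed ` J \<subseteq> group_closure {y * z | y z. y \<in> embed ` J \<and> z \<in> embed ` J}"
    by (intro image_subsetI embed_group_closure subsetD [OF idem])
  then have "embed x \<in> embed ` J"
    using power by (rule idempotent_ideal_mem_if_power_mem [OF two_sided_ideal_embed [OF J idem]])
  then show "x \<in> ideal_power I (Suc n)"
    by (auto simp: J_def)
qed

theorem corollaryC:
  fixes I :: "'a::cstar_algebra set"
  assumes "two_sided_ideal I"
  shows "(\<forall>n\<ge>1. ideal_power I n = I) \<or> (\<forall>n\<ge>1. ideal_power I (n + 1) \<subset> ideal_power I n)"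
proof (rule disjCI)
  assume "\<not> (\<forall>n\<ge>1. ideal_power I (n + 1) \<subset> ideal_power I n)"
  then obtain m where "m \<ge> 1" and m: "\<not> ideal_power I (m + 1) \<subset> ideal_power I m"
    by blast
  from \<open>m \<ge> 1\<close> obtain n where n: "m = Suc n"
    by (cases m) auto
  \<comment> \<open>One inclusion always holds, so a failure of strictness is an equality.\<close>
  have stable: "ideal_power I (Suc n) \<subseteq> ideal_power I (Suc (Suc n))"
    using m ideal_power_Suc_subset [OF assms, of n] unfolding n Suc_eq_plus1 [symmetric] by blast
  have I1: "ideal_power I (Suc 0) = I"
    using ideal_power_1 [OF assms] by simp
  have "ideal_power I (Suc k) = I" for k
  proof (rule antisym)
    show "ideal_power I (Suc k) \<subseteq> I"
      using ideal_power_antimono [OF assms, of 0 k] I1 by simp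
    \<comment> \<open>The exponent \<open>Suc (n + k)\<close> lies above both: stability moves up to
      it from \<open>Suc n\<close>, and the power for \<open>Suc k\<close> contains it.\<close>
    have "I \<subseteq> ideal_power I (Suc (n + k))"
      using ideal_subset_stable_power [OF assms stable] ideal_power_stable [OF stable] by blast
    also have "\<dots> \<subseteq> ideal_power I (Suc k)"
      using ideal_power_antimono [OF assms, of k n] by (simp add: add.commute)
    finally show "I \<subseteq> ideal_power I (Suc k)" .
  qed
  then show "\<forall>n\<ge>1. ideal_power I n = I"
    by (auto dest: Suc_le_D)
qed

end
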